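(* Let $\mathbf A(t)\in\mathbb R^{m\times n}$ be the solution of the matrix differential equation $\dot{\mathbf A}(t)=\mathbf F(t,\mathbf A(t))$, and let $t_1=t_0+h$ with stepsize $h>0$ and $0\le t_0<t_1\le T$. Assume that the following conditions hold in the Frobenius norm $\|\cdot\|$: (i) $\mathbf F$ is Lipschitz-continuous and bounded: for all $\mathbf Y,\mathbf Z\in\mathbb R^{m\times n}$ and $0\le t\le T$, $\|\mathbf F(t,\mathbf Y)-\mathbf F(t,\mathbf Z)\|\le L\|\mathbf Y-\mathbf Z\|$ and $\|\mathbf F(t,\mathbf Y)\|\le B$; (ii) the normal component of $\mathbf F$ is small: $\|P_r^\perp(\mathbf Y)\mathbf F(t,\mathbf Y)\|\le\varepsilon_r$ and $\|P_{\hat r}^\perp(\widehat{\mathbf Y})\mathbf F(t,\widehat{\mathbf Y})\|\le\varepsilon_{\hat r}$ for all $\mathbf Y\in\mathcal M_r$ and $\widehat{\mathbf Y}\in\mathcal M_{\hat r}$ in a neighbourhood of $\mathbf A(t)$ and for $0\le t\le T$. Assume that $\mathbf A(t_0)=\mathbf Y_0=\mathbf U_0\mathbf S_0\mathbf V_0^\top$ is of rank $r$. Let $\overline{\mathbf Y}_1$ be the rank-augmented (not truncated) result of one step of the midpoint BUG integrator with stepsize $h$ started from $\mathbf Y_0$, where $\hat r\le 2r$ is the rank of the midpoint approximation computed in this step (see the context). Then the local error is bounded by $$\|\overline{\mathbf Y}_1-\mathbf A(t_1)\|\le C\,h\,(h^2+h\,\varepsilon_r+\varepsilon_{\hat r}),$$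 where $C$ depends only on $L$ and $B$ in (i), on the bound of third derivatives of the exact solution $\mathbf A(t)$ of the matrix differential equation, and on an upper bound of the stepsize $h$.
   Context: Here $\mathbf F$ maps $[0,T]\times\mathbb R^{m\times n}$ to $\mathbb R^{m\times n}$, and $\|\cdot\|$ is the Frobenius norm. $\mathcal M_r$ is the manifold of real $m\times n$ matrices of rank $r$. Rank-$r$ matrices are written as $\mathbf Y=\mathbf U\mathbf S\mathbf V^\top$, where $\mathbf U\in\mathbb R^{m\times r}$ and $\mathbf V\in\mathbb R^{n\times r}$ have orthonormal columns and $\mathbf S\in\mathbb R^{r\times r}$ is invertible (not necessarily diagonal); this applies in particular to $\mathbf Y_0=\mathbf U_0\mathbf S_0\mathbf V_0^\top$. $P_r(\mathbf Y)$ is the orthogonal projection onto the tangent space of $\mathcal M_r$ at $\mathbf Y=\mathbf U\mathbf S\mathbf V^\top$, $$P_r(\mathbf Y)\mathbf Z=\mathbf Z\mathbf V\mathbf V^\top-\mathbf U\mathbf U^\top\mathbf Z\mathbf V\mathbf V^\top+\mathbf U\mathbf U^\top\mathbf Z,\quad \mathbf Z\in\mathbb R^{m\times n},\qquad P_r^\perp(\mathbf Y)=I-P_r(\mathbf Y),$$ and $P_{\hat r}$, $P_{\hat r}^\perp$ are defined in the same way with $\hat r$ in place of $r$. For matrices $\mathbf X_1,\dots,\mathbf X_k$ with the same number of rows, $\mathrm{orth}(\mathbf X_1,\dots,\mathbf X_k)$ denotes a matrix whose columns form an orthonormal basis of the range of the block matrix $(\mathbf X_1,\dots,\mathbf X_k)$.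 One step of the midpoint BUG integrator from $t_0$ to $t_1=t_0+h$, with $t_{1/2}=t_0+h/2$, starting from $\mathbf Y_0=\mathbf U_0\mathbf S_0\mathbf V_0^\top$ of rank $r$: Step 1 (midpoint approximation: a step of the augmented BUG integrator with stepsize $h/2$, without truncation). - K-step: solve on $[t_0,t_{1/2}]$ the $m\times r$ equation $\dot{\mathbf K}(t)=\mathbf F(t,\mathbf K(t)\mathbf V_0^\top)\mathbf V_0$, $\mathbf K(t_0)=\mathbf U_0\mathbf S_0$; set $\widehat{\mathbf U}_{1/2}=\mathrm{orth}(\mathbf U_0,\mathbf K(t_{1/2}))\in\mathbb R^{m\times\hat r}$ and $\widehat{\mathbf M}=\widehat{\mathbf U}_{1/2}^\top\mathbf U_0$. - L-step: solve on $[t_0,t_{1/2}]$ the $n\times r$ equation $\dot{\mathbf L}(t)=\mathbf F(t,\mathbf U_0\mathbf L(t)^\top)^\top\mathbf U_0$, $\mathbf L(t_0)=\mathbf V_0\mathbf S_0^\top$; set $\widehat{\mathbf V}_{1/2}=\mathrm{orth}(\mathbf V_0,\mathbf L(t_{1/2}))\in\mathbb R^{n\times\hat r}$ and $\widehat{\mathbf N}=\widehat{\mathbf V}_{1/2}^\top\mathbf V_0$. - S-step: solve on $[t_0,t_{1/2}]$ the $\hat r\times\hat r$ equation $\dot{\widehat{\mathbf S}}(t)=\widehat{\mathbf U}_{1/2}^\top\mathbf F(t,\widehat{\mathbf U}_{1/2}\widehat{\mathbf S}(t)\widehat{\mathbf V}_{1/2}^\top)\widehat{\mathbf V}_{1/2}$,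 $\widehat{\mathbf S}(t_0)=\widehat{\mathbf M}\mathbf S_0\widehat{\mathbf N}^\top$; set $\widehat{\mathbf Y}_{1/2}=\widehat{\mathbf U}_{1/2}\widehat{\mathbf S}(t_{1/2})\widehat{\mathbf V}_{1/2}^\top\approx\mathbf A(t_{1/2})$, the approximation of rank $\hat r\le 2r$. Step 2 (Galerkin step). Compute the augmented orthonormal bases of rank $\bar r\le4r$, $$\overline{\mathbf U}=\mathrm{orth}\big(\widehat{\mathbf U}_{1/2},\,h\mathbf F(t_{1/2},\widehat{\mathbf Y}_{1/2})\widehat{\mathbf V}_{1/2}\big),\qquad \overline{\mathbf V}=\mathrm{orth}\big(\widehat{\mathbf V}_{1/2},\,h\mathbf F(t_{1/2},\widehat{\mathbf Y}_{1/2})^\top\widehat{\mathbf U}_{1/2}\big),$$ and the $\bar r\times r$ matrices $\overline{\mathbf M}=\overline{\mathbf U}^\top\mathbf U_0$, $\overline{\mathbf N}=\overline{\mathbf V}^\top\mathbf V_0$. Solve on $[t_0,t_1]$ the $\bar r\times\bar r$ equation $$\dot{\overline{\mathbf S}}(t)=\overline{\mathbf U}^\top\mathbf F(t,\overline{\mathbf U}\,\overline{\mathbf S}(t)\overline{\mathbf V}^\top)\overline{\mathbf V},\qquad\overline{\mathbf S}(t_0)=\overline{\mathbf M}\mathbf S_0\overline{\mathbf N}^\top.$$ The rank-augmented result is $\overline{\mathbf Y}_1=\overline{\mathbf U}\,\overline{\mathbf S}(t_1)\overline{\mathbf V}^\top\approx\mathbf A(t_1)$.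
   Formalization: The neighbourhood of A(t) in (ii) is taken to be a ball of radius ρ, the same for all t and both ranks, with the added condition Bh < ρ, so that it contains the computed approximations; for arbitrarily small neighbourhoods and C independent of them the claim is false. *)

theory Defs
  imports Complex_Main "Jordan_Normal_Form.DL_Rank"
begin

(* Matrices carry their dimensions as values (carrier_mat m n), not as types, so that a
   constant can be quantified ahead of the dimensions and is then uniform in them. *)

definition frob_norm :: "real mat \<Rightarrow> real" where
  "frob_norm A = sqrt (\<Sum>i<dim_row A. \<Sum>j<dim_col A. (A $$ (i, j))\<^sup>2)"

(* The type of matrices is not a topological space; derivatives are taken entrywise. *)
definition has_mat_derivative ::
  "nat \<Rightarrow> nat \<Rightarrow> (real \<Rightarrow> real mat) \<Rightarrow> (real \<Rightarrow> real mat) \<Rightarrow> real set \<Rightarrow> bool" where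
  "has_mat_derivative p q X X' I \<longleftrightarrow>
    (\<forall>t\<in>I. X t \<in> carrier_mat p q \<and> X' t \<in> carrier_mat p q \<and>
      (\<forall>i<p. \<forall>j<q. ((\<lambda>s. X s $$ (i, j)) has_real_derivative X' t $$ (i, j)) (at t within I)))"

definition mat_solves_ivp ::
  "nat \<Rightarrow> nat \<Rightarrow> (real \<Rightarrow> real mat \<Rightarrow> real mat) \<Rightarrow> real \<Rightarrow> real \<Rightarrow> real mat \<Rightarrow> (real \<Rightarrow> real mat) \<Rightarrow> bool"
where
  "mat_solves_ivp p q G a b X0 X \<longleftrightarrow>
    has_mat_derivative p q X (\<lambda>t. G t (X t)) {a..b} \<and> X a = X0"

definition third_derivative_bound ::
  "nat \<Rightarrow> nat \<Rightarrow> (real \<Rightarrow> real mat) \<Rightarrow> real set \<Rightarrow> real \<Rightarrow> bool" where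
  "third_derivative_bound m n A I D \<longleftrightarrow>
    (\<exists>A1 A2 A3. has_mat_derivative m n A A1 I \<and> has_mat_derivative m n A1 A2 I \<and>
      has_mat_derivative m n A2 A3 I \<and> (\<forall>t\<in>I. frob_norm (A3 t) \<le> D))"

definition orthonormal_cols :: "nat \<Rightarrow> nat \<Rightarrow> real mat \<Rightarrow> bool" where
  "orthonormal_cols p k Q \<longleftrightarrow> Q \<in> carrier_mat p k \<and> Q\<^sup>T * Q = 1\<^sub>m k"

definition hcat :: "nat \<Rightarrow> real mat \<Rightarrow> real mat \<Rightarrow> real mat" where
  "hcat p X1 X2 = mat_of_cols p (cols X1 @ cols X2)"

(* orth(X) is determined only up to the choice of the orthonormal basis, hence a relation. *)
definition is_orth :: "nat \<Rightarrow> nat \<Rightarrow> real mat \<Rightarrow> real mat \<Rightarrow> bool" where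
  "is_orth p k X Q \<longleftrightarrow>
    orthonormal_cols p k Q \<and> vec_space.col_space p Q = vec_space.col_space p X"

definition rank_manifold :: "nat \<Rightarrow> nat \<Rightarrow> nat \<Rightarrow> real mat set" where
  "rank_manifold m n r = {Y \<in> carrier_mat m n. vec_space.rank m Y = r}"

definition low_rank_factors ::
  "nat \<Rightarrow> nat \<Rightarrow> nat \<Rightarrow> real mat \<Rightarrow> real mat \<Rightarrow> real mat \<Rightarrow> real mat \<Rightarrow> bool" where
  "low_rank_factors m n r Y U S V \<longleftrightarrow>
    orthonormal_cols m r U \<and> orthonormal_cols n r V \<and>
    S \<in> carrier_mat r r \<and> invertible_mat S \<and> Y = U * S * V\<^sup>T"

definition tangent_proj :: "real mat \<Rightarrow> real mat \<Rightarrow> real mat \<Rightarrow> real mat" where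
  "tangent_proj U V Z = Z * (V * V\<^sup>T) - (U * U\<^sup>T) * Z * (V * V\<^sup>T) + (U * U\<^sup>T) * Z"

definition normal_proj :: "real mat \<Rightarrow> real mat \<Rightarrow> real mat \<Rightarrow> real mat" where
  "normal_proj U V Z = Z - tangent_proj U V Z"

(* The neighbourhood of A t is the open Frobenius ball of radius \<rho>.  The projection depends on
   Y only, not on the factors (U and V are orthonormal bases of the column and row space of Y),
   so quantifying over all factorizations is the same as fixing one. *)
definition normal_component_bound ::
  "nat \<Rightarrow> nat \<Rightarrow> nat \<Rightarrow> (real \<Rightarrow> real mat \<Rightarrow> real mat) \<Rightarrow> real \<Rightarrow> (real \<Rightarrow> real mat) \<Rightarrow> real \<Rightarrow> real \<Rightarrow> bool"
where
  "normal_component_bound m n r F T A \<rho> \<epsilon> \<longleftrightarrow>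
    (\<forall>t\<in>{0..T}. \<forall>Y\<in>rank_manifold m n r. frob_norm (Y - A t) < \<rho> \<longrightarrow>
      (\<forall>U S V. low_rank_factors m n r Y U S V \<longrightarrow>
        frob_norm (normal_proj U V (F t Y)) \<le> \<epsilon>))"

definition lipschitz_bounded_field ::
  "nat \<Rightarrow> nat \<Rightarrow> (real \<Rightarrow> real mat \<Rightarrow> real mat) \<Rightarrow> real \<Rightarrow> real \<Rightarrow> real \<Rightarrow> bool" where
  "lipschitz_bounded_field m n F T L B \<longleftrightarrow>
    (\<forall>t\<in>{0..T}. \<forall>Y\<in>carrier_mat m n. F t Y \<in> carrier_mat m n \<and> frob_norm (F t Y) \<le> B) \<and>
    (\<forall>t\<in>{0..T}. \<forall>Y\<in>carrier_mat m n. \<forall>Z\<in>carrier_mat m n.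
      frob_norm (F t Y - F t Z) \<le> L * frob_norm (Y - Z))"

(* Galerkin approximation of the differential equation in the bases U (m x k) and V (n x k),
   started from the projection of U0 S0 V0^T; the result at time b is Y. *)
definition galerkin_step ::
  "nat \<Rightarrow> (real \<Rightarrow> real mat \<Rightarrow> real mat) \<Rightarrow> real \<Rightarrow> real \<Rightarrow> real mat \<Rightarrow> real mat \<Rightarrow> real mat \<Rightarrow>
    real mat \<Rightarrow> real mat \<Rightarrow> real mat \<Rightarrow> bool" where
  "galerkin_step k F a b U0 S0 V0 U V Y \<longleftrightarrow>
    (\<exists>S. mat_solves_ivp k k (\<lambda>t X. U\<^sup>T * F t (U * X * V\<^sup>T) * V) a b
           ((U\<^sup>T * U0) * S0 * (V\<^sup>T * V0)\<^sup>T) S \<and>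
         Y = U * S b * V\<^sup>T)"

definition augmented_bug_step ::
  "nat \<Rightarrow> nat \<Rightarrow> nat \<Rightarrow> nat \<Rightarrow> (real \<Rightarrow> real mat \<Rightarrow> real mat) \<Rightarrow> real \<Rightarrow> real \<Rightarrow>
    real mat \<Rightarrow> real mat \<Rightarrow> real mat \<Rightarrow> real mat \<Rightarrow> real mat \<Rightarrow> real mat \<Rightarrow> bool" where
  "augmented_bug_step m n r rh F a b U0 S0 V0 Uh Vh Yh \<longleftrightarrow>
    (\<exists>K. mat_solves_ivp m r (\<lambda>t X. F t (X * V0\<^sup>T) * V0) a b (U0 * S0) K \<and>
         is_orth m rh (hcat m U0 (K b)) Uh) \<and>
    (\<exists>Lf. mat_solves_ivp n r (\<lambda>t X. (F t (U0 * X\<^sup>T))\<^sup>T * U0) a b (V0 * S0\<^sup>T) Lf \<and>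
         is_orth n rh (hcat n V0 (Lf b)) Vh) \<and>
    galerkin_step rh F a b U0 S0 V0 Uh Vh Yh"

(* Y1 is the rank-augmented (not truncated) result after one step of size h. *)
definition midpoint_bug_step ::
  "nat \<Rightarrow> nat \<Rightarrow> nat \<Rightarrow> nat \<Rightarrow> (real \<Rightarrow> real mat \<Rightarrow> real mat) \<Rightarrow> real \<Rightarrow> real \<Rightarrow>
    real mat \<Rightarrow> real mat \<Rightarrow> real mat \<Rightarrow> real mat \<Rightarrow> bool" where
  "midpoint_bug_step m n r rh F t0 h U0 S0 V0 Y1 \<longleftrightarrow>
    (\<exists>Uh Vh Yh rb Ub Vb.
      augmented_bug_step m n r rh F t0 (t0 + h / 2) U0 S0 V0 Uh Vh Yh \<and>
      is_orth m rb (hcat m Uh (h \<cdot>\<^sub>m (F (t0 + h / 2) Yh * Vh))) Ub \<and>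
      is_orth n rb (hcat n Vh (h \<cdot>\<^sub>m ((F (t0 + h / 2) Yh)\<^sup>T * Uh))) Vb \<and>
      galerkin_step rb F t0 (t0 + h) U0 S0 V0 Ub Vb Y1)"

end

theory Submission
  imports Defs "Jordan_Normal_Form.Char_Poly" "HOL-Analysis.L2_Norm"
begin

text \<open>Fix orthonormal bases \<open>U\<close>, \<open>V\<close> and let \<open>P Z = U U\<^sup>T Z V V\<^sup>T\<close> be the orthogonal projection onto
  the matrices with range in that of \<open>U\<close> and row space in that of \<open>V\<close>.  A Galerkin step in these
  bases solves \<open>Y' = P F(t, Y)\<close>.  Comparing \<open>Y\<close> with \<open>P A\<close> by a Gronwall argument shows that its error
  is \<open>O(h)\<close> times the largest defect \<open>A(t) - P A(t)\<close> on the interval plus the defect at the end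
  (\<open>galerkin_error\<close>).  So everything depends on how well the bases capture the exact solution.

  The half step is accurate to first order up to the normal component.  Put \<open>k = h/2\<close>.  The equations
  for \<open>K\<close> and \<open>L\<close> are the exact flow multiplied by \<open>V\<^sub>0 V\<^sub>0\<^sup>T\<close> from the right and by \<open>U\<^sub>0 U\<^sub>0\<^sup>T\<close> from the
  left, up to \<open>O(k\<^sup>2)\<close>, and together with \<open>P\<^sub>r\<^sup>\<bottom>(Y\<^sub>0)\<close> these two multiplications decompose the
  increment of \<open>A\<close>.  As the normal part of the increment is at most \<open>k \<epsilon>\<^sub>r + O(k\<^sup>2)\<close>, the augmented
  bases capture \<open>A(t\<^sub>0 + k)\<close> up to \<open>O(h\<^sup>2 + h \<epsilon>\<^sub>r)\<close> (\<open>augmented_basis_defect\<close>), and the midpoint value is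
  equally accurate (\<open>half_step_accuracy\<close>).

  The second augmentation contains the tangential part of \<open>F\<close> at the midpoint value, so its bases
  capture \<open>A'(t\<^sub>0 + k)\<close> up to \<open>O(\<epsilon>\<^sub>r\<^sub>h + h\<^sup>2 + h \<epsilon>\<^sub>r)\<close>.  The defect \<open>g = A - P A\<close> for these bases
  vanishes at \<open>t\<^sub>0\<close>, is small together with its derivative at the midpoint, and has third derivative
  at most \<open>D\<close>.  The midpoint rule makes \<open>g(t\<^sub>0 + h)\<close> smaller by a factor \<open>h\<close> than \<open>g'(t\<^sub>0 + k)\<close>, up to
  \<open>O(h\<^sup>3)\<close>, and quadratic interpolation bounds \<open>g\<close> on the whole step
  (\<open>projected_solution_interpolation\<close>).  Interpolation takes the place of a bound on \<open>A''\<close>, since on a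
  time interval of length \<open>h\<close> the constants \<open>B\<close> and \<open>D\<close> yield only \<open>A'' = O(1/h)\<close>.  Inserting both bounds in
  \<open>galerkin_error\<close> gives the theorem.

  All constants must be independent of the dimensions.  Estimates are therefore made in the
  Frobenius norm, never entry by entry: a matrix function is tested with a fixed matrix in the
  Frobenius inner product, and one-variable calculus is applied to the resulting real function.\<close>

section \<open>The Frobenius inner product\<close>

declare minus_carrier_mat [simp]

definition frob_inner :: "real mat \<Rightarrow> real mat \<Rightarrow> real" where
  "frob_inner X Y = (\<Sum>i<dim_row X. \<Sum>j<dim_col X. X $$ (i, j) * Y $$ (i, j))"

lemma frob_norm_nonneg: "0 \<le> frob_norm A"
  unfolding frob_norm_def by (intro real_sqrt_ge_zero sum_nonneg) auto

lemma frob_inner_self: "frob_inner A A = (frob_norm A)\<^sup>2"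
proof -
  have "0 \<le> (\<Sum>i<dim_row A. \<Sum>j<dim_col A. (A $$ (i, j))\<^sup>2)"
    by (intro sum_nonneg) auto
  thus ?thesis unfolding frob_norm_def frob_inner_def by (simp add: power2_eq_square)
qed

lemma frob_norm_L2_set:
  "frob_norm A = L2_set (\<lambda>(i, j). A $$ (i, j)) ({..<dim_row A} \<times> {..<dim_col A})"
  unfolding frob_norm_def L2_set_def by (simp add: sum.cartesian_product case_prod_beta)

lemma frob_inner_abs_le:
  assumes "X \<in> carrier_mat p q" "Y \<in> carrier_mat p q"
  shows "\<bar>frob_inner X Y\<bar> \<le> frob_norm X * frob_norm Y"
proof -
  let ?I = "{..<p} \<times> {..<q}"
  have "\<bar>frob_inner X Y\<bar> = \<bar>\<Sum>x\<in>?I. X $$ x * Y $$ x\<bar>"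
    using assms unfolding frob_inner_def by (simp add: sum.cartesian_product case_prod_beta)
  also have "\<dots> \<le> (\<Sum>x\<in>?I. \<bar>X $$ x\<bar> * \<bar>Y $$ x\<bar>)"
    unfolding abs_mult[symmetric] by (rule sum_abs)
  also have "\<dots> \<le> L2_set (\<lambda>x. X $$ x) ?I * L2_set (\<lambda>x. Y $$ x) ?I"
    by (rule L2_set_mult_ineq)
  also have "\<dots> = frob_norm X * frob_norm Y"
    using assms by (simp add: frob_norm_L2_set case_prod_beta)
  finally show ?thesis .
qed

lemma frob_inner_minus_left:
  "\<lbrakk>X \<in> carrier_mat p q; Y \<in> carrier_mat p q; Z \<in> carrier_mat p q\<rbrakk>
    \<Longrightarrow> frob_inner (X - Y) Z = frob_inner X Z - frob_inner Y Z"
  unfolding frob_inner_def by (simp add: left_diff_distrib sum_subtractf)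

lemma frob_inner_minus_right:
  "\<lbrakk>X \<in> carrier_mat p q; Y \<in> carrier_mat p q; Z \<in> carrier_mat p q\<rbrakk>
    \<Longrightarrow> frob_inner Z (X - Y) = frob_inner Z X - frob_inner Z Y"
  unfolding frob_inner_def by (simp add: right_diff_distrib sum_subtractf)

lemma frob_inner_commute:
  "\<lbrakk>X \<in> carrier_mat p q; Y \<in> carrier_mat p q\<rbrakk> \<Longrightarrow> frob_inner X Y = frob_inner Y X"
  unfolding frob_inner_def by (simp add: mult.commute)

lemma frob_inner_transpose:
  "\<lbrakk>X \<in> carrier_mat p q; Y \<in> carrier_mat p q\<rbrakk> \<Longrightarrow> frob_inner X\<^sup>T Y\<^sup>T = frob_inner X Y"
  unfolding frob_inner_def by (simp, subst sum.swap, simp)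

lemma frob_inner_mult_left:
  assumes G: "G \<in> carrier_mat p k" and X: "X \<in> carrier_mat k q" and Y: "Y \<in> carrier_mat p q"
  shows "frob_inner (G * X) Y = frob_inner X (G\<^sup>T * Y)"
proof -
  have "frob_inner (G * X) Y = (\<Sum>i<p. \<Sum>j<q. \<Sum>l<k. G $$ (i,l) * X $$ (l,j) * Y $$ (i,j))"
    using assms unfolding frob_inner_def
    by (auto intro!: sum.cong simp: scalar_prod_def sum_distrib_right atLeast0LessThan)
  also have "\<dots> = (\<Sum>i<p. \<Sum>l<k. \<Sum>j<q. G $$ (i,l) * X $$ (l,j) * Y $$ (i,j))"
    by (intro sum.cong sum.swap) auto
  also have "\<dots> = (\<Sum>l<k. \<Sum>i<p. \<Sum>j<q. G $$ (i,l) * X $$ (l,j) * Y $$ (i,j))"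
    by (rule sum.swap)
  also have "\<dots> = (\<Sum>l<k. \<Sum>j<q. \<Sum>i<p. G $$ (i,l) * X $$ (l,j) * Y $$ (i,j))"
    by (intro sum.cong sum.swap) auto
  also have "\<dots> = frob_inner X (G\<^sup>T * Y)"
    using assms unfolding frob_inner_def
    by (auto intro!: sum.cong simp: scalar_prod_def sum_distrib_left atLeast0LessThan ac_simps)
  finally show ?thesis .
qed

lemma frob_inner_mult_right:
  assumes H: "H \<in> carrier_mat k q" and X: "X \<in> carrier_mat p k" and Y: "Y \<in> carrier_mat p q"
  shows "frob_inner (X * H) Y = frob_inner X (Y * H\<^sup>T)"
proof -
  have "frob_inner (X * H) Y = frob_inner (X * H)\<^sup>T Y\<^sup>T"
    using assms by (metis frob_inner_transpose mult_carrier_mat)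
  also have "\<dots> = frob_inner (H\<^sup>T * X\<^sup>T) Y\<^sup>T"
    using transpose_mult[OF X H] by simp
  also have "\<dots> = frob_inner X\<^sup>T (H * Y\<^sup>T)"
    using assms frob_inner_mult_left[of "H\<^sup>T" q k "X\<^sup>T" p "Y\<^sup>T"] by simp
  also have "H * Y\<^sup>T = (Y * H\<^sup>T)\<^sup>T"
    using transpose_mult[OF Y, of "H\<^sup>T" k] H by simp
  also have "frob_inner X\<^sup>T (Y * H\<^sup>T)\<^sup>T = frob_inner X (Y * H\<^sup>T)"
    using assms by (metis frob_inner_transpose mult_carrier_mat transpose_carrier_mat)
  finally show ?thesis .
qed

text \<open>This is what allows scalar calculus to prove norm estimates without a dimension factor.\<close>

lemma frob_norm_le_dual:
  assumes Z: "Z \<in> carrier_mat p q" and K: "0 \<le> K"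
    and dual: "\<And>E. E \<in> carrier_mat p q \<Longrightarrow> frob_inner Z E \<le> K * frob_norm E"
  shows "frob_norm Z \<le> K"
proof (cases "frob_norm Z = 0")
  case False
  hence pos: "frob_norm Z > 0" using frob_norm_nonneg[of Z] by simp
  have "frob_norm Z * frob_norm Z \<le> K * frob_norm Z"
    using dual[OF Z] by (simp add: frob_inner_self power2_eq_square)
  thus ?thesis using pos by simp
qed (use K in simp)

lemma frob_norm_add_le:
  assumes "X \<in> carrier_mat p q" "Y \<in> carrier_mat p q"
  shows "frob_norm (X + Y) \<le> frob_norm X + frob_norm Y"
proof -
  have "frob_norm (X + Y) = L2_set (\<lambda>x. X $$ x + Y $$ x) ({..<p} \<times> {..<q})"
    unfolding frob_norm_L2_set using assms by (intro L2_set_cong) auto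
  also have "\<dots> \<le> L2_set (\<lambda>x. X $$ x) ({..<p} \<times> {..<q}) + L2_set (\<lambda>x. Y $$ x) ({..<p} \<times> {..<q})"
    by (rule L2_set_triangle_ineq)
  also have "\<dots> = frob_norm X + frob_norm Y"
    using assms by (simp add: frob_norm_L2_set case_prod_beta)
  finally show ?thesis .
qed

lemma frob_norm_minus_commute:
  "\<lbrakk>X \<in> carrier_mat p q; Y \<in> carrier_mat p q\<rbrakk> \<Longrightarrow> frob_norm (X - Y) = frob_norm (Y - X)"
  unfolding frob_norm_def by (auto intro!: sum.cong simp: power2_commute)

lemma frob_norm_triangle:
  assumes "X \<in> carrier_mat p q" "Y \<in> carrier_mat p q" "Z \<in> carrier_mat p q"
  shows "frob_norm (X - Z) \<le> frob_norm (X - Y) + frob_norm (Y - Z)"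
proof -
  have "X - Z = (X - Y) + (Y - Z)" using assms by (intro eq_matI) auto
  thus ?thesis using frob_norm_add_le[of "X - Y" p q "Y - Z"] assms by simp
qed

lemma frob_norm_le_add_minus:
  assumes "X \<in> carrier_mat p q" "Y \<in> carrier_mat p q"
  shows "frob_norm X \<le> frob_norm Y + frob_norm (X - Y)"
proof -
  have "X = Y + (X - Y)" using assms by (intro eq_matI) auto
  thus ?thesis using frob_norm_add_le[of Y p q "X - Y"] assms by simp
qed

lemma frob_norm_smult: "frob_norm (c \<cdot>\<^sub>m X) = \<bar>c\<bar> * frob_norm X"
  unfolding frob_norm_def
  by (simp add: power_mult_distrib sum_distrib_left[symmetric] real_sqrt_mult)

section \<open>Derivatives of matrix functions\<close>

lemma has_mat_derivativeD:
  assumes "has_mat_derivative p q X X' I" "t \<in> I"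
  shows "X t \<in> carrier_mat p q" "X' t \<in> carrier_mat p q"
    "\<And>i j. i < p \<Longrightarrow> j < q \<Longrightarrow>
      ((\<lambda>s. X s $$ (i, j)) has_real_derivative X' t $$ (i, j)) (at t within I)"
  using assms unfolding has_mat_derivative_def by auto

lemma has_mat_derivative_subset:
  "has_mat_derivative p q X X' I \<Longrightarrow> J \<subseteq> I \<Longrightarrow> has_mat_derivative p q X X' J"
  unfolding has_mat_derivative_def by (meson DERIV_subset subsetD)

lemma has_mat_derivative_const:
  "Z \<in> carrier_mat p q \<Longrightarrow> has_mat_derivative p q (\<lambda>t. Z) (\<lambda>t. 0\<^sub>m p q) I"
  unfolding has_mat_derivative_def by auto

text \<open>Off the interval a matrix function may have other dimensions, so an entry of a matrix
  expression equals the expected expression in the entries only on the interval.\<close>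

lemma has_mat_derivative_entrywise:
  assumes "\<And>t. t \<in> I \<Longrightarrow> X t \<in> carrier_mat p q" "\<And>t. t \<in> I \<Longrightarrow> X' t \<in> carrier_mat p q"
    and "\<And>i j t. i < p \<Longrightarrow> j < q \<Longrightarrow> t \<in> I \<Longrightarrow> X t $$ (i, j) = f i j t"
    and "\<And>i j t. i < p \<Longrightarrow> j < q \<Longrightarrow> t \<in> I \<Longrightarrow>
      (f i j has_real_derivative X' t $$ (i, j)) (at t within I)"
  shows "has_mat_derivative p q X X' I"
  unfolding has_mat_derivative_def
proof (intro ballI conjI allI impI)
  fix t i j assume t: "t \<in> I" and ij: "i < p" "j < q"
  show "((\<lambda>s. X s $$ (i, j)) has_real_derivative X' t $$ (i, j)) (at t within I)"
    using assms(4)[OF ij t]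
    by (rule has_field_derivative_transform_within[where d = 1]) (use t assms(3)[OF ij] in auto)
qed (use assms(1,2) in auto)

lemma has_mat_derivative_minus:
  assumes X: "has_mat_derivative p q X X' I" and Y: "has_mat_derivative p q Y Y' I"
  shows "has_mat_derivative p q (\<lambda>t. X t - Y t) (\<lambda>t. X' t - Y' t) I"
proof (rule has_mat_derivative_entrywise[where f = "\<lambda>i j t. X t $$ (i, j) - Y t $$ (i, j)"])
  fix i j t assume h: "i < p" "j < q" "t \<in> I"
  show "((\<lambda>t. X t $$ (i, j) - Y t $$ (i, j)) has_real_derivative (X' t - Y' t) $$ (i, j))
      (at t within I)"
    using DERIV_diff[OF has_mat_derivativeD(3)[OF X h(3,1,2)] has_mat_derivativeD(3)[OF Y h(3,1,2)]]
      has_mat_derivativeD(2)[OF X h(3)] has_mat_derivativeD(2)[OF Y h(3)] h by simp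
next
  fix i j t assume h: "i < p" "j < q" "t \<in> I"
  show "(X t - Y t) $$ (i, j) = X t $$ (i, j) - Y t $$ (i, j)"
    using has_mat_derivativeD(1)[OF X h(3)] has_mat_derivativeD(1)[OF Y h(3)] h by simp
qed (use has_mat_derivativeD(1,2)[OF X] has_mat_derivativeD(1,2)[OF Y] in auto)

lemma has_mat_derivative_mult_left:
  assumes G: "G \<in> carrier_mat p k" and X: "has_mat_derivative k q X X' I"
  shows "has_mat_derivative p q (\<lambda>t. G * X t) (\<lambda>t. G * X' t) I"
proof (rule has_mat_derivative_entrywise[where f = "\<lambda>i j t. \<Sum>l<k. G $$ (i, l) * X t $$ (l, j)"])
  have entry: "(G * Z) $$ (i, j) = (\<Sum>l<k. G $$ (i, l) * Z $$ (l, j))"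
    if "Z \<in> carrier_mat k q" "i < p" "j < q" for Z i j
    using that G by (auto simp: scalar_prod_def atLeast0LessThan)
  fix i j t assume h: "i < p" "j < q" "t \<in> I"
  show "(G * X t) $$ (i, j) = (\<Sum>l<k. G $$ (i, l) * X t $$ (l, j))"
    using entry[OF has_mat_derivativeD(1)[OF X h(3)] h(1,2)] .
  have "((\<lambda>t. \<Sum>l<k. G $$ (i, l) * X t $$ (l, j)) has_real_derivative
      (\<Sum>l<k. G $$ (i, l) * X' t $$ (l, j))) (at t within I)"
    using has_mat_derivativeD(3)[OF X h(3)] h by (auto intro!: DERIV_sum DERIV_cmult)
  thus "((\<lambda>t. \<Sum>l<k. G $$ (i, l) * X t $$ (l, j)) has_real_derivative (G * X' t) $$ (i, j))
      (at t within I)"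
    using entry[OF has_mat_derivativeD(2)[OF X h(3)] h(1,2)] by simp
qed (use G has_mat_derivativeD(1,2)[OF X] in auto)

lemma has_mat_derivative_transpose:
  assumes X: "has_mat_derivative p q X X' I"
  shows "has_mat_derivative q p (\<lambda>t. (X t)\<^sup>T) (\<lambda>t. (X' t)\<^sup>T) I"
proof (rule has_mat_derivative_entrywise[where f = "\<lambda>i j t. X t $$ (j, i)"])
  fix i j t assume h: "i < q" "j < p" "t \<in> I"
  show "(X t)\<^sup>T $$ (i, j) = X t $$ (j, i)"
    using has_mat_derivativeD(1)[OF X h(3)] h by simp
  show "((\<lambda>t. X t $$ (j, i)) has_real_derivative (X' t)\<^sup>T $$ (i, j)) (at t within I)"
    using has_mat_derivativeD(2,3)[OF X h(3)] h by simp
qed (use has_mat_derivativeD(1,2)[OF X] in auto)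

lemma has_mat_derivative_cong:
  assumes "has_mat_derivative p q X X' I"
    and "\<And>t. t \<in> I \<Longrightarrow> X t = Y t" "\<And>t. t \<in> I \<Longrightarrow> X' t = Y' t"
  shows "has_mat_derivative p q Y Y' I"
proof (rule has_mat_derivative_entrywise[where f = "\<lambda>i j t. X t $$ (i, j)"])
qed (use has_mat_derivativeD[OF assms(1)] assms(2,3) in auto)

lemma has_mat_derivative_mult_right:
  assumes H: "H \<in> carrier_mat k q" and X: "has_mat_derivative p k X X' I"
  shows "has_mat_derivative p q (\<lambda>t. X t * H) (\<lambda>t. X' t * H) I"
proof (rule has_mat_derivative_cong)
  show "has_mat_derivative p q (\<lambda>t. (H\<^sup>T * (X t)\<^sup>T)\<^sup>T) (\<lambda>t. (H\<^sup>T * (X' t)\<^sup>T)\<^sup>T) I"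
    using H X by (intro has_mat_derivative_transpose has_mat_derivative_mult_left) auto
  show "(H\<^sup>T * (X t)\<^sup>T)\<^sup>T = X t * H" "(H\<^sup>T * (X' t)\<^sup>T)\<^sup>T = X' t * H" if "t \<in> I" for t
    using transpose_mult[of "H\<^sup>T" q k "(X t)\<^sup>T" p] transpose_mult[of "H\<^sup>T" q k "(X' t)\<^sup>T" p]
      has_mat_derivativeD(1,2)[OF X that] H by simp_all
qed

lemma frob_inner_has_derivative:
  assumes X: "has_mat_derivative p q X X' I" and Y: "has_mat_derivative p q Y Y' I" and t: "t \<in> I"
  shows "((\<lambda>t. frob_inner (X t) (Y t)) has_real_derivative
      frob_inner (X' t) (Y t) + frob_inner (X t) (Y' t)) (at t within I)"
proof -
  note D = has_mat_derivativeD[OF X t] has_mat_derivativeD[OF Y t]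
  have "((\<lambda>t. \<Sum>i<p. \<Sum>j<q. X t $$ (i, j) * Y t $$ (i, j)) has_real_derivative
      (\<Sum>i<p. \<Sum>j<q. X' t $$ (i, j) * Y t $$ (i, j) + Y' t $$ (i, j) * X t $$ (i, j))) (at t within I)"
    using D by (intro DERIV_sum DERIV_mult) auto
  also have "(\<Sum>i<p. \<Sum>j<q. X' t $$ (i, j) * Y t $$ (i, j) + Y' t $$ (i, j) * X t $$ (i, j)) =
      frob_inner (X' t) (Y t) + frob_inner (X t) (Y' t)"
    using D unfolding frob_inner_def by (simp add: sum.distrib mult.commute)
  finally show ?thesis
    by (rule has_field_derivative_transform_within[where d = 1])
      (use t has_mat_derivativeD(1)[OF X] in \<open>auto simp: frob_inner_def\<close>)
qed

corollary frob_inner_const_has_derivative: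
  assumes X: "has_mat_derivative p q X X' I" and E: "E \<in> carrier_mat p q" and t: "t \<in> I"
  shows "((\<lambda>t. frob_inner (X t) E) has_real_derivative frob_inner (X' t) E) (at t within I)"
proof -
  have "frob_inner (X t) (0\<^sub>m p q) = 0"
    unfolding frob_inner_def using has_mat_derivativeD(1)[OF X t] by simp
  thus ?thesis using frob_inner_has_derivative[OF X has_mat_derivative_const[OF E] t] by simp
qed

text \<open>The one-sided derivatives at the end points supply the continuity required there by the mean
  value theorem.\<close>

lemma mvt_within:
  fixes f :: "real \<Rightarrow> real"
  assumes "a < b" and f: "\<And>t. t \<in> {a..b} \<Longrightarrow> (f has_real_derivative f' t) (at t within {a..b})"
  obtains \<xi> where "\<xi> \<in> {a<..<b}" "f b - f a = (b - a) * f' \<xi>"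
proof -
  have cont: "continuous_on {a..b} f"
    by (rule DERIV_continuous_on[OF f])
  have "(f has_derivative (\<lambda>v. v * f' x)) (at x)" if "a < x" "x < b" for x
    using f[of x] that by (simp add: has_field_derivative_def at_within_Icc_at mult.commute[of _ "f' x"] )
  from mvt[OF assms(1) cont this] obtain \<xi> where "a < \<xi>" "\<xi> < b" "f b - f a = (b - a) * f' \<xi>"
    by metis
  thus thesis using that by simp
qed

lemma abs_diff_le_of_derivative_bound:
  fixes f :: "real \<Rightarrow> real"
  assumes f: "\<And>t. t \<in> {a..b} \<Longrightarrow> (f has_real_derivative f' t) (at t within {a..b})"
    and bound: "\<And>t. t \<in> {a..b} \<Longrightarrow> \<bar>f' t\<bar> \<le> K"
    and xy: "x \<in> {a..b}" "y \<in> {a..b}"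
  shows "\<bar>f x - f y\<bar> \<le> K * \<bar>x - y\<bar>"
proof -
  have *: "\<bar>f v - f u\<bar> \<le> K * (v - u)" if "u < v" "u \<in> {a..b}" "v \<in> {a..b}" for u v
  proof -
    have "(f has_real_derivative f' t) (at t within {u..v})" if "t \<in> {u..v}" for t
      by (rule DERIV_subset[OF f]) (use that \<open>u \<in> _\<close> \<open>v \<in> _\<close> in auto)
    from mvt_within[OF \<open>u < v\<close> this] obtain \<xi>
      where \<xi>: "\<xi> \<in> {u<..<v}" "f v - f u = (v - u) * f' \<xi>" by blast
    have "\<bar>f' \<xi>\<bar> \<le> K" using bound[of \<xi>] \<xi>(1) that by auto
    thus ?thesis using \<xi>(2) \<open>u < v\<close> by (simp add: abs_mult mult.commute mult_right_mono)
  qed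
  show ?thesis
    using *[of x y] *[of y x] xy by (cases x y rule: linorder_cases) (auto simp: abs_minus_commute)
qed

text \<open>The mean value theorem is applied to \<open>t \<mapsto> frob_inner (X t) E\<close> for each test matrix \<open>E\<close>; the
  intermediate point depends on \<open>E\<close>, the bound does not.\<close>

lemma mat_mean_value_inequality:
  assumes X: "has_mat_derivative p q X X' {a..b}" and "a \<le> b"
    and bound: "\<And>t. t \<in> {a..b} \<Longrightarrow> frob_norm (X' t) \<le> K"
  shows "frob_norm (X b - X a) \<le> K * (b - a)"
proof (rule frob_norm_le_dual)
  have ab: "a \<in> {a..b}" "b \<in> {a..b}" using \<open>a \<le> b\<close> by auto
  note Xab = has_mat_derivativeD(1)[OF X ab(1)] has_mat_derivativeD(1)[OF X ab(2)]
  show "X b - X a \<in> carrier_mat p q" using Xab by simp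
  have "0 \<le> K" using bound[OF ab(1)] frob_norm_nonneg[of "X' a"] by linarith
  thus "0 \<le> K * (b - a)" using \<open>a \<le> b\<close> by simp
  fix E :: "real mat" assume E: "E \<in> carrier_mat p q"
  show "frob_inner (X b - X a) E \<le> K * (b - a) * frob_norm E"
  proof (cases "a < b")
    case True
    obtain \<xi> where \<xi>: "\<xi> \<in> {a<..<b}"
      "frob_inner (X b) E - frob_inner (X a) E = (b - a) * frob_inner (X' \<xi>) E"
      using mvt_within[OF True frob_inner_const_has_derivative[OF X E]] by blast
    have "frob_inner (X' \<xi>) E \<le> frob_norm (X' \<xi>) * frob_norm E"
      using frob_inner_abs_le[OF has_mat_derivativeD(2)[OF X] E, of \<xi>] \<xi>(1) by auto
    also have "\<dots> \<le> K * frob_norm E"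
      using \<xi>(1) by (intro mult_right_mono bound frob_norm_nonneg) auto
    finally have "(b - a) * frob_inner (X' \<xi>) E \<le> (b - a) * (K * frob_norm E)"
      using True by (intro mult_left_mono) auto
    thus ?thesis
      using \<xi>(2) frob_inner_minus_left[OF Xab(2,1) E] by (simp add: ac_simps)
  next
    case False
    hence "a = b" using \<open>a \<le> b\<close> by simp
    thus ?thesis using frob_inner_minus_left[OF Xab(2,1) E] by simp
  qed
qed

section \<open>Growth estimates\<close>

text \<open>The mean value inequality is applied three times, because the third derivative may be
  discontinuous; this replaces the factor \<open>1/6\<close> of Taylor's formula by \<open>1\<close>.\<close>

lemma taylor2_bound:
  fixes f0 f1 f2 f3 :: "real \<Rightarrow> real"
  assumes "0 \<le> k"
    and d0: "\<And>t. t \<in> {c-k..c+k} \<Longrightarrow> (f0 has_real_derivative f1 t) (at t within {c-k..c+k})"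
    and d1: "\<And>t. t \<in> {c-k..c+k} \<Longrightarrow> (f1 has_real_derivative f2 t) (at t within {c-k..c+k})"
    and d2: "\<And>t. t \<in> {c-k..c+k} \<Longrightarrow> (f2 has_real_derivative f3 t) (at t within {c-k..c+k})"
    and bound: "\<And>t. t \<in> {c-k..c+k} \<Longrightarrow> \<bar>f3 t\<bar> \<le> D"
    and s: "s \<in> {c-k..c+k}"
  shows "\<bar>f0 s - f0 c - f1 c * (s - c) - f2 c * (s - c)\<^sup>2 / 2\<bar> \<le> D * k^3"
proof -
  have c: "c \<in> {c-k..c+k}" using \<open>0 \<le> k\<close> by simp
  have D: "0 \<le> D" using bound[OF c] by linarith
  have step: "\<bar>g u - g c\<bar> \<le> K * k"
    if "\<And>t. t \<in> {c-k..c+k} \<Longrightarrow> (g has_real_derivative g' t) (at t within {c-k..c+k})"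
      "\<And>t. t \<in> {c-k..c+k} \<Longrightarrow> \<bar>g' t\<bar> \<le> K" "u \<in> {c-k..c+k}" "0 \<le> K" for g g' :: "real \<Rightarrow> real" and K u
  proof -
    have "\<bar>g u - g c\<bar> \<le> K * \<bar>u - c\<bar>"
      by (rule abs_diff_le_of_derivative_bound[OF that(1,2,3) c])
    also have "\<dots> \<le> K * k" using that(3,4) by (intro mult_left_mono) auto
    finally show ?thesis .
  qed
  have r2: "\<bar>f2 t - f2 c\<bar> \<le> D * k" if "t \<in> {c-k..c+k}" for t
    by (rule step[OF d2 bound that D])
  have r1: "\<bar>f1 t - f1 c - f2 c * (t - c)\<bar> \<le> D * k * k" if t: "t \<in> {c-k..c+k}" for t
  proof -
    have "((\<lambda>t. f1 t - f2 c * (t - c)) has_real_derivative f2 u - f2 c) (at u within {c-k..c+k})"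
      if "u \<in> {c-k..c+k}" for u
      using d1[OF that] by (auto intro!: derivative_eq_intros)
    from step[OF this r2 t] show ?thesis using D \<open>0 \<le> k\<close> by (simp add: algebra_simps)
  qed
  have "((\<lambda>t. f0 t - f1 c * (t - c) - f2 c * (t - c)\<^sup>2 / 2) has_real_derivative
      f1 u - f1 c - f2 c * (u - c)) (at u within {c-k..c+k})" if "u \<in> {c-k..c+k}" for u
    using d0[OF that] by (auto intro!: derivative_eq_intros simp: field_simps)
  from step[OF this r1 s] show ?thesis
    using D \<open>0 \<le> k\<close> by (simp add: power3_eq_cube algebra_simps)
qed

text \<open>Both bounds come from the Taylor polynomial of degree two at the midpoint.  Its unknown quadratic
  coefficient cancels between the two end points, which gives the midpoint rule, and it is
  determined up to small terms by the zero at the left end, which gives the bound inside.\<close>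

lemma midpoint_interpolation:
  fixes f0 f1 f2 f3 :: "real \<Rightarrow> real"
  assumes "0 \<le> k"
    and d: "\<And>t. t \<in> {c-k..c+k} \<Longrightarrow> (f0 has_real_derivative f1 t) (at t within {c-k..c+k})"
      "\<And>t. t \<in> {c-k..c+k} \<Longrightarrow> (f1 has_real_derivative f2 t) (at t within {c-k..c+k})"
      "\<And>t. t \<in> {c-k..c+k} \<Longrightarrow> (f2 has_real_derivative f3 t) (at t within {c-k..c+k})"
    and bound: "\<And>t. t \<in> {c-k..c+k} \<Longrightarrow> \<bar>f3 t\<bar> \<le> D"
    and zero: "f0 (c - k) = 0"
  shows "\<bar>f0 (c + k)\<bar> \<le> 2 * k * \<bar>f1 c\<bar> + 2 * D * k^3"
    and "s \<in> {c-k..c+k} \<Longrightarrow> \<bar>f0 s\<bar> \<le> 2 * \<bar>f0 c\<bar> + 2 * k * \<bar>f1 c\<bar> + 2 * D * k^3"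
proof -
  have T: "\<bar>f0 s - f0 c - f1 c * (s - c) - f2 c * (s - c)\<^sup>2 / 2\<bar> \<le> D * k^3"
    if "s \<in> {c-k..c+k}" for s
    by (rule taylor2_bound[OF \<open>0 \<le> k\<close> d bound that])
  have left: "\<bar>- f0 c + f1 c * k - f2 c * k\<^sup>2 / 2\<bar> \<le> D * k^3"
    using T[of "c - k"] zero \<open>0 \<le> k\<close> by simp
  have right: "\<bar>f0 (c + k) - f0 c - f1 c * k - f2 c * k\<^sup>2 / 2\<bar> \<le> D * k^3"
    using T[of "c + k"] \<open>0 \<le> k\<close> by simp
  have f1k: "\<bar>f1 c * k\<bar> = k * \<bar>f1 c\<bar>" using \<open>0 \<le> k\<close> by (simp add: abs_mult)
  show "\<bar>f0 (c + k)\<bar> \<le> 2 * k * \<bar>f1 c\<bar> + 2 * D * k^3"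
    using left right f1k by linarith
  assume s: "s \<in> {c-k..c+k}"
  have sk: "\<bar>s - c\<bar> \<le> k" using s by auto
  have "\<bar>f1 c * (s - c)\<bar> \<le> k * \<bar>f1 c\<bar>"
    using mult_left_mono[OF sk, of "\<bar>f1 c\<bar>"] by (simp add: abs_mult mult.commute)
  moreover have "\<bar>f2 c * (s - c)\<^sup>2 / 2\<bar> \<le> \<bar>f2 c * k\<^sup>2 / 2\<bar>"
    using mult_left_mono[OF power_mono[OF sk, of 2], of "\<bar>f2 c\<bar> / 2"] by (simp add: abs_mult)
  moreover have "\<bar>f2 c * k\<^sup>2 / 2\<bar> \<le> D * k^3 + \<bar>f0 c\<bar> + k * \<bar>f1 c\<bar>"
    using left f1k by linarith
  ultimately show "\<bar>f0 s\<bar> \<le> 2 * \<bar>f0 c\<bar> + 2 * k * \<bar>f1 c\<bar> + 2 * D * k^3"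
    using T[OF s] by linarith
qed

lemma mat_midpoint_interpolation:
  assumes "0 \<le> k"
    and d: "has_mat_derivative p q X X1 {c-k..c+k}" "has_mat_derivative p q X1 X2 {c-k..c+k}"
      "has_mat_derivative p q X2 X3 {c-k..c+k}"
    and bound: "\<And>t. t \<in> {c-k..c+k} \<Longrightarrow> frob_norm (X3 t) \<le> D"
    and zero: "X (c - k) = 0\<^sub>m p q"
  shows "frob_norm (X (c + k)) \<le> 2 * k * frob_norm (X1 c) + 2 * D * k^3"
    and "s \<in> {c-k..c+k} \<Longrightarrow>
      frob_norm (X s) \<le> 2 * frob_norm (X c) + 2 * k * frob_norm (X1 c) + 2 * D * k^3"
proof -
  have c: "c \<in> {c-k..c+k}" "c + k \<in> {c-k..c+k}" using \<open>0 \<le> k\<close> by auto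
  have D: "0 \<le> D" using bound[OF c(1)] frob_norm_nonneg[of "X3 c"] by linarith
  note Xc = has_mat_derivativeD(1)[OF d(1) c(1)] and X1c = has_mat_derivativeD(2)[OF d(1) c(1)]
  have scalar:
    "\<bar>frob_inner (X (c + k)) E\<bar> \<le> 2 * k * \<bar>frob_inner (X1 c) E\<bar> + 2 * (D * frob_norm E) * k^3"
    "s \<in> {c-k..c+k} \<Longrightarrow> \<bar>frob_inner (X s) E\<bar> \<le>
      2 * \<bar>frob_inner (X c) E\<bar> + 2 * k * \<bar>frob_inner (X1 c) E\<bar> + 2 * (D * frob_norm E) * k^3"
    if E: "E \<in> carrier_mat p q" for E s
  proof -
    have b: "\<bar>frob_inner (X3 t) E\<bar> \<le> D * frob_norm E" if "t \<in> {c-k..c+k}" for t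
      using frob_inner_abs_le[OF has_mat_derivativeD(2)[OF d(3) that] E]
        mult_right_mono[OF bound[OF that] frob_norm_nonneg[of E]] by linarith
    have z: "frob_inner (X (c - k)) E = 0" unfolding zero frob_inner_def by simp
    note M = midpoint_interpolation[OF \<open>0 \<le> k\<close> frob_inner_const_has_derivative[OF d(1) E]
      frob_inner_const_has_derivative[OF d(2) E] frob_inner_const_has_derivative[OF d(3) E] b z]
    show "\<bar>frob_inner (X (c + k)) E\<bar> \<le> 2 * k * \<bar>frob_inner (X1 c) E\<bar> + 2 * (D * frob_norm E) * k^3"
      by (rule M(1)) auto
    show "\<bar>frob_inner (X s) E\<bar> \<le>
      2 * \<bar>frob_inner (X c) E\<bar> + 2 * k * \<bar>frob_inner (X1 c) E\<bar> + 2 * (D * frob_norm E) * k^3"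
      if "s \<in> {c-k..c+k}" using that by (intro M(2)) auto
  qed
  have E1: "2 * k * \<bar>frob_inner (X1 c) E\<bar> \<le> 2 * k * (frob_norm (X1 c) * frob_norm E)"
    if "E \<in> carrier_mat p q" for E
    using frob_inner_abs_le[OF X1c that] \<open>0 \<le> k\<close> by (intro mult_left_mono) auto
  show "frob_norm (X (c + k)) \<le> 2 * k * frob_norm (X1 c) + 2 * D * k^3"
  proof (rule frob_norm_le_dual[OF has_mat_derivativeD(1)[OF d(1) c(2)]])
    show "0 \<le> 2 * k * frob_norm (X1 c) + 2 * D * k^3"
      using \<open>0 \<le> k\<close> D frob_norm_nonneg by simp
    fix E :: "real mat" assume E: "E \<in> carrier_mat p q"
    show "frob_inner (X (c + k)) E \<le> (2 * k * frob_norm (X1 c) + 2 * D * k^3) * frob_norm E"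
      using scalar(1)[OF E] E1[OF E] by (simp add: algebra_simps)
  qed
  assume s: "s \<in> {c-k..c+k}"
  show "frob_norm (X s) \<le> 2 * frob_norm (X c) + 2 * k * frob_norm (X1 c) + 2 * D * k^3"
  proof (rule frob_norm_le_dual[OF has_mat_derivativeD(1)[OF d(1) s]])
    show "0 \<le> 2 * frob_norm (X c) + 2 * k * frob_norm (X1 c) + 2 * D * k^3"
      using \<open>0 \<le> k\<close> D frob_norm_nonneg by simp
    fix E :: "real mat" assume E: "E \<in> carrier_mat p q"
    show "frob_inner (X s) E \<le>
        (2 * frob_norm (X c) + 2 * k * frob_norm (X1 c) + 2 * D * k^3) * frob_norm E"
      using scalar(2)[OF E s] E1[OF E] frob_inner_abs_le[OF Xc E] by (simp add: algebra_simps)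
  qed
qed

text \<open>Gronwall's inequality for \<open>\<parallel>X\<parallel>\<^sup>2 + \<eta>\<^sup>2\<close>, which unlike \<open>\<parallel>X\<parallel>\<close> is differentiable, gives
  \<open>\<parallel>X\<parallel> \<le> exp (2 L (b - a)) \<eta>\<close>.  This loses the factor \<open>b - a\<close>; inserting it in the growth condition
  and using the mean value inequality once more restores that factor.\<close>

lemma mat_gronwall:
  assumes X: "has_mat_derivative p q X X' {a..b}" and "a \<le> b" and "0 \<le> L" and "0 \<le> \<eta>"
    and growth: "\<And>t. t \<in> {a..b} \<Longrightarrow> frob_norm (X' t) \<le> L * (frob_norm (X t) + \<eta>)"
    and zero: "X a = 0\<^sub>m p q"
  shows "frob_norm (X b) \<le> (b - a) * (L * (1 + exp (2 * L * (b - a))) * \<eta>)"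
proof -
  have zero': "frob_norm (X a) = 0" unfolding zero frob_norm_def by simp
  have bound: "frob_norm (X s) \<le> exp (2 * L * (b - a)) * \<eta>" if s: "s \<in> {a..b}" for s
  proof (cases "a < s")
    case True
    \<comment> \<open>The rate \<open>3 L\<close> absorbs the mixed term: \<open>2 x (x + \<eta>) \<le> 3 (x\<^sup>2 + \<eta>\<^sup>2)\<close>.\<close>
    let ?f = "\<lambda>t. (frob_inner (X t) (X t) + \<eta>\<^sup>2) * exp (- (3 * L * t))"
    let ?f' = "\<lambda>t. (2 * frob_inner (X t) (X' t) - 3 * L * (frob_inner (X t) (X t) + \<eta>\<^sup>2)) * exp (- (3 * L * t))"
    have Xs: "has_mat_derivative p q X X' {a..s}"
      by (rule has_mat_derivative_subset[OF X]) (use s in auto)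
    have "(?f has_real_derivative ?f' t) (at t within {a..s})" if t: "t \<in> {a..s}" for t
    proof -
      note D = frob_inner_has_derivative[OF Xs Xs t]
      have "frob_inner (X' t) (X t) = frob_inner (X t) (X' t)"
        by (rule frob_inner_commute[OF has_mat_derivativeD(2,1)[OF Xs t]])
      with D show ?thesis
        by (auto intro!: derivative_eq_intros simp: algebra_simps)
    qed
    from mvt_within[OF True this] obtain \<xi>
      where \<xi>: "\<xi> \<in> {a<..<s}" "?f s - ?f a = (s - a) * ?f' \<xi>" by blast
    have "?f' \<xi> \<le> 0"
    proof (rule mult_nonpos_nonneg)
      have t: "\<xi> \<in> {a..b}" using \<xi>(1) s by auto
      let ?x = "frob_norm (X \<xi>)"
      have "frob_inner (X \<xi>) (X' \<xi>) \<le> ?x * frob_norm (X' \<xi>)"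
        using frob_inner_abs_le[OF has_mat_derivativeD(1,2)[OF X t]] by linarith
      also have "\<dots> \<le> ?x * (L * (?x + \<eta>))"
        by (rule mult_left_mono[OF growth[OF t] frob_norm_nonneg])
      finally have "2 * frob_inner (X \<xi>) (X' \<xi>) \<le> L * (2 * ?x\<^sup>2 + 2 * ?x * \<eta>)"
        by (simp add: algebra_simps power2_eq_square)
      also have "\<dots> \<le> L * (3 * (?x\<^sup>2 + \<eta>\<^sup>2))"
      proof (rule mult_left_mono[OF _ \<open>0 \<le> L\<close>])
        show "2 * ?x\<^sup>2 + 2 * ?x * \<eta> \<le> 3 * (?x\<^sup>2 + \<eta>\<^sup>2)"
          using sum_squares_bound[of ?x \<eta>] zero_le_power2[of \<eta>] unfolding distrib_left by linarith
      qed
      finally show "2 * frob_inner (X \<xi>) (X' \<xi>) - 3 * L * (frob_inner (X \<xi>) (X \<xi>) + \<eta>\<^sup>2) \<le> 0"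
        by (simp add: frob_inner_self ac_simps)
    qed simp
    hence "?f s \<le> ?f a" using \<xi>(2) mult_nonneg_nonpos[of "s - a" "?f' \<xi>"] True by linarith
    hence "?f s * exp (3 * L * s) \<le> ?f a * exp (3 * L * s)" by (rule mult_right_mono) simp
    hence "(frob_norm (X s))\<^sup>2 + \<eta>\<^sup>2 \<le> \<eta>\<^sup>2 * exp (3 * L * (s - a))"
      using zero' by (simp add: frob_inner_self mult.assoc exp_add[symmetric] right_diff_distrib)
    also have "\<dots> \<le> \<eta>\<^sup>2 * (exp (2 * L * (b - a)))\<^sup>2"
    proof (rule mult_left_mono)
      have "3 * L * (s - a) \<le> 4 * L * (b - a)"
        using s \<open>0 \<le> L\<close> \<open>a < s\<close> by (intro mult_mono) auto
      thus "exp (3 * L * (s - a)) \<le> (exp (2 * L * (b - a)))\<^sup>2"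
        by (simp add: exp_double[symmetric])
    qed simp
    finally have "(frob_norm (X s))\<^sup>2 + \<eta>\<^sup>2 \<le> (exp (2 * L * (b - a)) * \<eta>)\<^sup>2"
      by (simp add: power_mult_distrib mult.commute)
    hence "(frob_norm (X s))\<^sup>2 \<le> (exp (2 * L * (b - a)) * \<eta>)\<^sup>2"
      using zero_le_power2[of \<eta>] by linarith
    thus ?thesis by (rule power2_le_imp_le) (use \<open>0 \<le> \<eta>\<close> in simp)
  next
    case False
    hence "s = a" using s by auto
    thus ?thesis using zero' \<open>0 \<le> \<eta>\<close> by simp
  qed
  have "frob_norm (X b - X a) \<le> L * (1 + exp (2 * L * (b - a))) * \<eta> * (b - a)"
  proof (rule mat_mean_value_inequality[OF X \<open>a \<le> b\<close>])
    fix t assume t: "t \<in> {a..b}"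
    have "frob_norm (X' t) \<le> L * (exp (2 * L * (b - a)) * \<eta> + \<eta>)"
      using growth[OF t] mult_left_mono[OF add_right_mono[OF bound[OF t]] \<open>0 \<le> L\<close>] by (rule order_trans)
    thus "frob_norm (X' t) \<le> L * (1 + exp (2 * L * (b - a))) * \<eta>" by (simp add: algebra_simps)
  qed
  moreover have "X b - X a = X b"
    unfolding zero using has_mat_derivativeD(1)[OF X, of b] \<open>a \<le> b\<close> by auto
  ultimately show ?thesis by (simp add: ac_simps)
qed

section \<open>Projections onto column and row spaces\<close>

text \<open>With the identity matrix for \<open>U\<close> or \<open>V\<close> this is also the one-sided projection that governs the
  equations for \<open>K\<close> and \<open>L\<close>, so that all equations of the integrator have the same form.\<close>

definition galerkin_proj :: "real mat \<Rightarrow> real mat \<Rightarrow> real mat \<Rightarrow> real mat" where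
  "galerkin_proj U V Z = (U * U\<^sup>T) * Z * (V * V\<^sup>T)"

lemma orthonormal_cols_one: "orthonormal_cols p p (1\<^sub>m p)"
  unfolding orthonormal_cols_def by simp

lemma orthonormal_colsD:
  assumes "orthonormal_cols p k U"
  shows "U \<in> carrier_mat p k" "U\<^sup>T * U = 1\<^sub>m k" "U * U\<^sup>T \<in> carrier_mat p p"
    "(U * U\<^sup>T)\<^sup>T = U * U\<^sup>T" "(U * U\<^sup>T) * U = U" "U\<^sup>T * (U * U\<^sup>T) = U\<^sup>T"
    "(U * U\<^sup>T) * (U * U\<^sup>T) = U * U\<^sup>T"
proof -
  show U: "U \<in> carrier_mat p k" and I: "U\<^sup>T * U = 1\<^sub>m k"
    using assms unfolding orthonormal_cols_def by auto
  have UT: "U\<^sup>T \<in> carrier_mat k p" using U by simp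
  show P: "U * U\<^sup>T \<in> carrier_mat p p" using U by simp
  show "(U * U\<^sup>T)\<^sup>T = U * U\<^sup>T" using transpose_mult[OF U UT] by simp
  show "(U * U\<^sup>T) * U = U" using assoc_mult_mat[OF U UT U] I U by simp
  show UP: "U\<^sup>T * (U * U\<^sup>T) = U\<^sup>T" using assoc_mult_mat[OF UT U UT] I UT by simp
  show "(U * U\<^sup>T) * (U * U\<^sup>T) = U * U\<^sup>T" using assoc_mult_mat[OF U UT P] UP by simp
qed

context
  fixes m n k l :: nat and U V :: "real mat"
  assumes U: "orthonormal_cols m k U" and V: "orthonormal_cols n l V"
begin

lemma galerkin_proj_carrier [simp]: "galerkin_proj U V Z \<in> carrier_mat m n"
  using orthonormal_colsD(1)[OF U] orthonormal_colsD(1)[OF V]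
  unfolding galerkin_proj_def by (intro carrier_matI) auto

lemma galerkin_proj_minus:
  assumes "X \<in> carrier_mat m n" "Y \<in> carrier_mat m n"
  shows "galerkin_proj U V (X - Y) = galerkin_proj U V X - galerkin_proj U V Y"
proof -
  note P = orthonormal_colsD(3)[OF U] and Q = orthonormal_colsD(3)[OF V]
  show ?thesis unfolding galerkin_proj_def mult_minus_distrib_mat[OF P assms]
    using P Q assms by (intro minus_mult_distrib_mat) auto
qed

lemma galerkin_proj_add:
  assumes "X \<in> carrier_mat m n" "Y \<in> carrier_mat m n"
  shows "galerkin_proj U V (X + Y) = galerkin_proj U V X + galerkin_proj U V Y"
proof -
  note P = orthonormal_colsD(3)[OF U] and Q = orthonormal_colsD(3)[OF V]
  show ?thesis unfolding galerkin_proj_def mult_add_distrib_mat[OF P assms]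
    using P Q assms by (intro add_mult_distrib_mat) auto
qed

lemma has_mat_derivative_galerkin_proj:
  assumes "has_mat_derivative m n X X' I"
  shows "has_mat_derivative m n (\<lambda>t. galerkin_proj U V (X t)) (\<lambda>t. galerkin_proj U V (X' t)) I"
  unfolding galerkin_proj_def
  using orthonormal_colsD(3)[OF U] orthonormal_colsD(3)[OF V] assms
  by (intro has_mat_derivative_mult_right has_mat_derivative_mult_left)

text \<open>Every matrix that has to be recognised as captured by a pair of bases is given in the form
  \<open>G W H\<^sup>T\<close>, with the columns of \<open>G\<close> and \<open>H\<close> in the ranges of the bases.\<close>

lemma galerkin_proj_fixes:
  assumes G: "(U * U\<^sup>T) * G = G" "G \<in> carrier_mat m a" and H: "(V * V\<^sup>T) * H = H" "H \<in> carrier_mat n b"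
    and W: "W \<in> carrier_mat a b"
  shows "galerkin_proj U V (G * W * H\<^sup>T) = G * W * H\<^sup>T"
proof -
  note P = orthonormal_colsD(3)[OF U] and Q = orthonormal_colsD(3)[OF V]
  have HT: "H\<^sup>T \<in> carrier_mat b n" and GW: "G * W \<in> carrier_mat m b" using assms by auto
  have HQ: "H\<^sup>T * (V * V\<^sup>T) = H\<^sup>T"
    using transpose_mult[OF Q H(2)] H(1) orthonormal_colsD(4)[OF V] by simp
  have "(U * U\<^sup>T) * (G * W * H\<^sup>T) = (U * U\<^sup>T) * G * W * H\<^sup>T"
    using assoc_mult_mat[OF P GW HT] assoc_mult_mat[OF P G(2) W] by simp
  also have "\<dots> = G * W * H\<^sup>T" using G(1) by simp
  finally show ?thesis
    unfolding galerkin_proj_def using assoc_mult_mat[OF GW HT Q] HQ by simp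
qed

lemma galerkin_proj_factored:
  assumes Z: "Z \<in> carrier_mat m n"
  shows "galerkin_proj U V Z = U * (U\<^sup>T * Z * V) * V\<^sup>T"
proof -
  note C = orthonormal_colsD(1)[OF U] orthonormal_colsD(1)[OF V]
  have "galerkin_proj U V Z = U * (U\<^sup>T * Z) * (V * V\<^sup>T)"
    unfolding galerkin_proj_def using assoc_mult_mat[of U m k "U\<^sup>T" m Z n] C Z by simp
  also have "\<dots> = U * (U\<^sup>T * Z) * V * V\<^sup>T"
    using assoc_mult_mat[of "U * (U\<^sup>T * Z)" m n V l "V\<^sup>T" n] C Z by simp
  also have "U * (U\<^sup>T * Z) * V = U * (U\<^sup>T * Z * V)"
    using assoc_mult_mat[of U m k "U\<^sup>T * Z" n V l] C Z by simp
  finally show ?thesis .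
qed

lemma galerkin_proj_idem:
  assumes Z: "Z \<in> carrier_mat m n"
  shows "galerkin_proj U V (galerkin_proj U V Z) = galerkin_proj U V Z"
  unfolding galerkin_proj_factored[OF Z]
  using orthonormal_colsD(1,5)[OF U] orthonormal_colsD(1,5)[OF V] Z
  by (intro galerkin_proj_fixes) auto

lemma frob_inner_galerkin_proj:
  assumes X: "X \<in> carrier_mat m n" and Y: "Y \<in> carrier_mat m n"
  shows "frob_inner (galerkin_proj U V X) Y = frob_inner X (galerkin_proj U V Y)"
proof -
  note P = orthonormal_colsD(3,4)[OF U] and Q = orthonormal_colsD(3,4)[OF V]
  have PX: "U * U\<^sup>T * X \<in> carrier_mat m n" and YQ: "Y * (V * V\<^sup>T) \<in> carrier_mat m n"
    using P Q X Y by auto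
  have "frob_inner (galerkin_proj U V X) Y = frob_inner (U * U\<^sup>T * X) (Y * (V * V\<^sup>T))"
    unfolding galerkin_proj_def using frob_inner_mult_right[OF Q(1) PX Y] Q(2) by simp
  also have "\<dots> = frob_inner X (U * U\<^sup>T * (Y * (V * V\<^sup>T)))"
    using frob_inner_mult_left[OF P(1) X YQ] P(2) by simp
  finally show ?thesis
    unfolding galerkin_proj_def using assoc_mult_mat[OF P(1) Y Q(1)] by simp
qed

lemma galerkin_proj_pythagoras:
  assumes Z: "Z \<in> carrier_mat m n"
  shows "(frob_norm (galerkin_proj U V Z))\<^sup>2 + (frob_norm (Z - galerkin_proj U V Z))\<^sup>2 = (frob_norm Z)\<^sup>2"
proof -
  let ?Z = "galerkin_proj U V Z"
  note [simp] = frob_inner_self[symmetric]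
  have "frob_inner ?Z ?Z = frob_inner ?Z Z"
    using frob_inner_galerkin_proj[OF galerkin_proj_carrier Z] galerkin_proj_idem[OF Z]
      frob_inner_galerkin_proj[OF Z galerkin_proj_carrier]
      frob_inner_commute[OF Z galerkin_proj_carrier] by metis
  moreover have "frob_inner ?Z Z = frob_inner Z ?Z"
    by (rule frob_inner_commute[OF galerkin_proj_carrier Z])
  ultimately show ?thesis
    using Z by (simp add: frob_inner_minus_left[where p = m and q = n]
      frob_inner_minus_right[where p = m and q = n])
qed

lemma frob_norm_galerkin_proj_le:
  "Z \<in> carrier_mat m n \<Longrightarrow> frob_norm (galerkin_proj U V Z) \<le> frob_norm Z"
  by (rule power2_le_imp_le[OF _ frob_norm_nonneg]) (metis galerkin_proj_pythagoras le_add_same_cancel1 zero_le_power2)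

lemma frob_norm_galerkin_defect_le:
  "Z \<in> carrier_mat m n \<Longrightarrow> frob_norm (Z - galerkin_proj U V Z) \<le> frob_norm Z"
  by (rule power2_le_imp_le[OF _ frob_norm_nonneg]) (metis galerkin_proj_pythagoras le_add_same_cancel2 zero_le_power2)

text \<open>A defect is estimated by exhibiting some matrix that the projection fixes; the projection
  itself never has to be computed.\<close>

lemma galerkin_proj_best_approx:
  assumes Z: "Z \<in> carrier_mat m n" and C: "C \<in> carrier_mat m n" "galerkin_proj U V C = C"
  shows "frob_norm (Z - galerkin_proj U V Z) \<le> frob_norm (Z - C)"
proof -
  have "(Z - C) - galerkin_proj U V (Z - C) = Z - galerkin_proj U V Z"
    unfolding galerkin_proj_minus[OF Z C(1)] C(2)
    using Z C carrier_matD[OF galerkin_proj_carrier[of Z]] by (intro eq_matI) auto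
  thus ?thesis using frob_norm_galerkin_defect_le[of "Z - C"] Z C(1) by simp
qed

end

text \<open>\<open>P\<^sup>\<bottom> Z = (I - U U\<^sup>T) Z (I - V V\<^sup>T)\<close>, so that contractivity and linearity are inherited from
  one-sided projections.\<close>

lemma normal_proj_two_defects:
  assumes U: "orthonormal_cols m k U" and V: "orthonormal_cols n l V" and Z: "Z \<in> carrier_mat m n"
  defines "W \<equiv> Z - galerkin_proj (1\<^sub>m m) V Z"
  shows "normal_proj U V Z = W - galerkin_proj U (1\<^sub>m n) W"
proof -
  note P = orthonormal_colsD(3)[OF U] and Q = orthonormal_colsD(3)[OF V]
  have one: "1\<^sub>m m * (1\<^sub>m m)\<^sup>T = (1\<^sub>m m :: real mat)" "1\<^sub>m n * (1\<^sub>m n)\<^sup>T = (1\<^sub>m n :: real mat)" by simp_all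
  have ZQ: "Z * (V * V\<^sup>T) \<in> carrier_mat m n" and PZ: "U * U\<^sup>T * Z \<in> carrier_mat m n"
    using P Q Z by auto
  have regroup: "A - (X - Y + B) = A - X - (B - Y)"
    if "A \<in> carrier_mat m n" "X \<in> carrier_mat m n" "Y \<in> carrier_mat m n" "B \<in> carrier_mat m n"
    for A X Y B :: "real mat"
    using that by (intro eq_matI) auto
  have W: "W = Z - Z * (V * V\<^sup>T)" unfolding W_def galerkin_proj_def one using Z by simp
  have "galerkin_proj U (1\<^sub>m n) W = U * U\<^sup>T * W"
    unfolding galerkin_proj_def one
    by (rule right_mult_one_mat[of _ m n], rule mult_carrier_mat[OF P]) (use Z ZQ W in simp)
  also have "\<dots> = U * U\<^sup>T * Z - U * U\<^sup>T * Z * (V * V\<^sup>T)"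
    unfolding W mult_minus_distrib_mat[OF P Z ZQ] using assoc_mult_mat[OF P Z Q] by simp
  finally show ?thesis
    unfolding normal_proj_def tangent_proj_def W using regroup[OF Z ZQ _ PZ] PZ Q by simp
qed

lemma normal_proj_carrier:
  "\<lbrakk>U \<in> carrier_mat m k; V \<in> carrier_mat n l; Z \<in> carrier_mat m n\<rbrakk> \<Longrightarrow> normal_proj U V Z \<in> carrier_mat m n"
  unfolding normal_proj_def tangent_proj_def by (intro carrier_matI) auto

lemma frob_norm_normal_proj_le:
  assumes U: "orthonormal_cols m k U" and V: "orthonormal_cols n l V" and Z: "Z \<in> carrier_mat m n"
  shows "frob_norm (normal_proj U V Z) \<le> frob_norm Z"
proof -
  let ?W = "Z - galerkin_proj (1\<^sub>m m) V Z"
  have W: "?W \<in> carrier_mat m n" using galerkin_proj_carrier[OF orthonormal_cols_one V] by simp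
  have "frob_norm (normal_proj U V Z) \<le> frob_norm ?W"
    unfolding normal_proj_two_defects[OF U V Z]
    by (rule frob_norm_galerkin_defect_le[OF U orthonormal_cols_one W])
  also have "\<dots> \<le> frob_norm Z"
    by (rule frob_norm_galerkin_defect_le[OF orthonormal_cols_one V Z])
  finally show ?thesis .
qed

lemma normal_proj_minus:
  assumes U: "orthonormal_cols m k U" and V: "orthonormal_cols n l V"
    and X: "X \<in> carrier_mat m n" and Y: "Y \<in> carrier_mat m n"
  shows "normal_proj U V (X - Y) = normal_proj U V X - normal_proj U V Y"
proof -
  note c1 = galerkin_proj_carrier[OF orthonormal_cols_one[of m] V] and
    c2 = galerkin_proj_carrier[OF U orthonormal_cols_one[of n]]
  let ?W = "\<lambda>Z. Z - galerkin_proj (1\<^sub>m m) V Z"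
  have W: "?W Z \<in> carrier_mat m n" for Z using c1 by simp
  have "?W (X - Y) = ?W X - ?W Y"
    unfolding galerkin_proj_minus[OF orthonormal_cols_one V X Y]
    using c1[of X] c1[of Y] X Y by (intro eq_matI) auto
  moreover have "(?W X - ?W Y) - galerkin_proj U (1\<^sub>m n) (?W X - ?W Y) =
      (?W X - galerkin_proj U (1\<^sub>m n) (?W X)) - (?W Y - galerkin_proj U (1\<^sub>m n) (?W Y))"
    unfolding galerkin_proj_minus[OF U orthonormal_cols_one W W]
    using c2[of "?W X"] c2[of "?W Y"] c1[of X] c1[of Y] X Y by (intro eq_matI) auto
  ultimately show ?thesis
    using normal_proj_two_defects[OF U V] X Y by simp
qed

lemma has_mat_derivative_normal_proj:
  assumes U: "orthonormal_cols m k U" and V: "orthonormal_cols n l V"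
    and X: "has_mat_derivative m n X X' I"
  shows "has_mat_derivative m n (\<lambda>t. normal_proj U V (X t)) (\<lambda>t. normal_proj U V (X' t)) I"
proof (rule has_mat_derivative_cong)
  let ?W = "\<lambda>Z. Z - galerkin_proj (1\<^sub>m m) V Z"
  show "has_mat_derivative m n (\<lambda>t. ?W (X t) - galerkin_proj U (1\<^sub>m n) (?W (X t)))
      (\<lambda>t. ?W (X' t) - galerkin_proj U (1\<^sub>m n) (?W (X' t))) I"
    by (intro has_mat_derivative_minus has_mat_derivative_galerkin_proj[OF U orthonormal_cols_one]
      has_mat_derivative_galerkin_proj[OF orthonormal_cols_one V] X)
qed (use normal_proj_two_defects[OF U V] has_mat_derivativeD[OF X] in auto)

section \<open>Orthonormal bases and rank\<close>

lemma mult_eq_if_cols_in_col_space: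
  assumes Q: "orthonormal_cols p k Q" and X: "X \<in> carrier_mat p a"
    and sub: "set (cols X) \<subseteq> vec_space.col_space p Q"
  shows "(Q * Q\<^sup>T) * X = X"
proof (rule mat_col_eqI)
  interpret vec_space "TYPE(real)" p .
  note D = orthonormal_colsD[OF Q]
  fix j assume j: "j < dim_col X"
  hence "col X j \<in> col_space Q" using sub by (auto simp: cols_def)
  then obtain v where v: "v \<in> carrier_vec k" "Q *\<^sub>v v = col X j"
    using col_space_eq[OF D(1)] D(1) by auto
  have "col ((Q * Q\<^sup>T) * X) j = (Q * Q\<^sup>T) *\<^sub>v col X j"
    using j X by (intro col_mult2[OF D(3) X]) simp
  also have "\<dots> = ((Q * Q\<^sup>T) * Q) *\<^sub>v v"
    using assoc_mult_mat_vec[OF D(3,1) v(1)] v(2) by simp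
  also have "\<dots> = col X j" unfolding D(5) by (rule v(2))
  finally show "col ((Q * Q\<^sup>T) * X) j = col X j" .
qed (use orthonormal_colsD(3)[OF Q] X in auto)

lemma is_orth_hcat_fixes:
  assumes orth: "is_orth p k (hcat p X1 X2) Q"
    and X: "X1 \<in> carrier_mat p a" "X2 \<in> carrier_mat p b"
  shows "(Q * Q\<^sup>T) * X1 = X1" "(Q * Q\<^sup>T) * X2 = X2"
proof -
  interpret vec_space "TYPE(real)" p .
  have c: "set (cols X1) \<subseteq> carrier_vec p" "set (cols X2) \<subseteq> carrier_vec p"
    using X cols_dim by blast+
  have "cols (hcat p X1 X2) = cols X1 @ cols X2"
    unfolding hcat_def using c by (intro cols_mat_of_cols) auto
  hence "set (cols X1) \<union> set (cols X2) \<subseteq> col_space (hcat p X1 X2)"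
    unfolding col_space_def using in_own_span[of "set (cols X1) \<union> set (cols X2)"] c by simp
  hence "set (cols X1) \<subseteq> col_space Q" "set (cols X2) \<subseteq> col_space Q"
    using orth unfolding is_orth_def by auto
  thus "(Q * Q\<^sup>T) * X1 = X1" "(Q * Q\<^sup>T) * X2 = X2"
    using mult_eq_if_cols_in_col_space X orth unfolding is_orth_def by blast+
qed

text \<open>Transitivity of the inclusion of column spaces, expressed by projections.\<close>

lemma nested_bases_fix:
  assumes Q: "orthonormal_cols p l Q" and Qh: "Qh \<in> carrier_mat p k" and X: "X \<in> carrier_mat p a"
    and nested: "(Q * Q\<^sup>T) * Qh = Qh" and fixes_h: "(Qh * Qh\<^sup>T) * X = X"
  shows "(Q * Q\<^sup>T) * X = X"
proof -
  have QT: "Qh\<^sup>T \<in> carrier_mat k p" using Qh by simp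
  have QTX: "Qh\<^sup>T * X \<in> carrier_mat k a" using QT X by simp
  have X': "Qh * (Qh\<^sup>T * X) = X" using assoc_mult_mat[OF Qh QT X] fixes_h by simp
  show ?thesis
    using assoc_mult_mat[OF orthonormal_colsD(3)[OF Q] Qh QTX] unfolding nested X' by simp
qed

text \<open>The integrator augments the bases by \<open>h\<close> times a block; the factor does not change the range.\<close>

lemma mult_smult_fixes_cancel:
  fixes P X :: "real mat"
  assumes "P \<in> carrier_mat p p" "X \<in> carrier_mat p a" "h \<noteq> 0" "P * (h \<cdot>\<^sub>m X) = h \<cdot>\<^sub>m X"
  shows "P * X = X"
proof -
  have eq: "h \<cdot>\<^sub>m (P * X) = h \<cdot>\<^sub>m X"
    using assms(4) mult_smult_distrib[OF assms(1,2)] by metis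
  show ?thesis
  proof (rule eq_matI)
    fix i j assume ij: "i < dim_row X" "j < dim_col X"
    have "(h \<cdot>\<^sub>m (P * X)) $$ (i, j) = (h \<cdot>\<^sub>m X) $$ (i, j)" unfolding eq ..
    thus "(P * X) $$ (i, j) = X $$ (i, j)" using ij assms(1-3) by auto
  qed (use assms(1,2) in auto)
qed

text \<open>The determinant of \<open>S + d I\<close> vanishes only when \<open>-d\<close> is a root of the characteristic polynomial,
  so only for finitely many \<open>d\<close>.\<close>

lemma invertible_shift_near_zero:
  fixes S :: "real mat"
  assumes S: "S \<in> carrier_mat k k" and "0 < e"
  obtains d where "0 < d" "d < e" "invertible_mat (S + d \<cdot>\<^sub>m 1\<^sub>m k)"
proof -
  have "char_poly S \<noteq> 0" using degree_monic_char_poly[OF S] by fastforce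
  hence fin: "finite ((\<lambda>x. - x) ` {x. poly (char_poly S) x = 0})"
    using poly_roots_finite by blast
  have "infinite {0<..<e}" using \<open>0 < e\<close> by (rule infinite_Ioo)
  then obtain d where d: "d \<in> {0<..<e}" "d \<notin> (\<lambda>x. - x) ` {x. poly (char_poly S) x = 0}"
    using finite_subset[OF _ fin] by blast
  have "poly (char_poly S) (- d) \<noteq> 0"
  proof
    assume "poly (char_poly S) (- d) = 0"
    hence "d \<in> (\<lambda>x. - x) ` {x. poly (char_poly S) x = 0}" by (intro image_eqI[of _ _ "- d"]) auto
    with d(2) show False by simp
  qed
  hence "det (char_matrix S (- d)) \<noteq> 0"
    using eigenvalue_root_char_poly[OF S] eigenvalue_det[OF S] by blast
  moreover have "char_matrix S (- d) = S + d \<cdot>\<^sub>m 1\<^sub>m k"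
    unfolding char_matrix_def using S by simp
  ultimately have "det (S + d \<cdot>\<^sub>m 1\<^sub>m k) \<noteq> 0" by simp
  from det_non_zero_imp_unit[OF _ this, of k] obtain B where
    "B \<in> carrier_mat k k" "(S + d \<cdot>\<^sub>m 1\<^sub>m k) * B = 1\<^sub>m k" "B * (S + d \<cdot>\<^sub>m 1\<^sub>m k) = 1\<^sub>m k"
    using S unfolding Units_def ring_mat_def by auto
  hence "invertible_mat (S + d \<cdot>\<^sub>m 1\<^sub>m k)"
    using S unfolding invertible_mat_def inverts_mat_def by auto
  with d(1) that show thesis by auto
qed

text \<open>Since \<open>S\<close> is invertible and \<open>V\<^sup>T V = I\<close>, the matrix \<open>U S V\<^sup>T\<close> has the same column space as \<open>U\<close>, whose
  columns are independent.\<close>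

lemma rank_low_rank_factors:
  assumes f: "low_rank_factors m n r Y U S V"
  shows "vec_space.rank m Y = r"
proof -
  interpret vec_space "TYPE(real)" m .
  have U: "orthonormal_cols m r U" and V: "orthonormal_cols n r V"
    and S: "S \<in> carrier_mat r r" and inv: "invertible_mat S" and Y: "Y = U * S * V\<^sup>T"
    using f unfolding low_rank_factors_def by auto
  note UD = orthonormal_colsD[OF U] and VD = orthonormal_colsD[OF V]
  obtain W where W: "inverts_mat S W" "inverts_mat W S" using inv unfolding invertible_mat_def by auto
  have SW: "S * W = 1\<^sub>m r" and WS': "W * S = 1\<^sub>m (dim_row W)"
    using W S unfolding inverts_mat_def by auto
  have WS: "W \<in> carrier_mat r r"
    using arg_cong[OF SW, of dim_col] arg_cong[OF WS', of dim_col] S by (intro carrier_matI) auto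
  have YC: "Y \<in> carrier_mat m n" unfolding Y using UD S VD by auto
  have VW: "V * W \<in> carrier_mat n r" and SV: "S * V\<^sup>T \<in> carrier_mat r n" using VD S WS by auto
  have YU: "Y = U * (S * V\<^sup>T)" unfolding Y using assoc_mult_mat[OF UD(1) S, of "V\<^sup>T" n] VD by simp
  have UY: "Y * (V * W) = U"
  proof -
    have US: "U * S \<in> carrier_mat m r" using UD S by simp
    have "Y * (V * W) = (Y * V) * W" using assoc_mult_mat[OF YC VD(1) WS] by simp
    also have "Y * V = U * S" unfolding Y
      using assoc_mult_mat[OF US _ VD(1), of "V\<^sup>T"] VD(1,2) US right_mult_one_mat[OF US] by simp
    also have "U * S * W = U" using assoc_mult_mat[OF UD(1) S WS] SW UD(1) by simp
    finally show ?thesis .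
  qed
  have "col_space Y = col_space U"
  proof (intro equalityI subsetI)
    fix y assume "y \<in> col_space Y"
    then obtain x where x: "x \<in> carrier_vec n" "Y *\<^sub>v x = y" using col_space_eq[OF YC] YC by auto
    have "U *\<^sub>v ((S * V\<^sup>T) *\<^sub>v x) = y"
      using assoc_mult_mat_vec[OF UD(1) SV x(1)] x(2) YU by simp
    thus "y \<in> col_space U"
      using col_space_eq[OF UD(1)] UD(1) SV x(1) mult_mat_vec_carrier[OF SV x(1)] by auto
  next
    fix y assume "y \<in> col_space U"
    then obtain x where x: "x \<in> carrier_vec r" "U *\<^sub>v x = y" using col_space_eq[OF UD(1)] UD(1) by auto
    have "Y *\<^sub>v ((V * W) *\<^sub>v x) = y"
      using assoc_mult_mat_vec[OF YC VW x(1)] x(2) UY by simp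
    thus "y \<in> col_space Y"
      using col_space_eq[OF YC] YC x(1) mult_mat_vec_carrier[OF VW x(1)] by auto
  qed
  hence "rank Y = rank U" unfolding rank_def col_space_def by simp
  moreover have "distinct (cols U)"
  proof -
    have "col U i \<noteq> col U j" if "i < r" "j < r" "i \<noteq> j" for i j
    proof
      assume eq: "col U i = col U j"
      have "(U\<^sup>T * U) $$ (i, i) = (U\<^sup>T * U) $$ (i, j)" using eq that UD(1) by simp
      thus False unfolding UD(2) using that by simp
    qed
    thus ?thesis using UD(1) by (auto simp: distinct_conv_nth)
  qed
  moreover have "lin_indpt (set (cols U))"
  proof
    assume "lin_dep (set (cols U))"
    then obtain v where v: "v \<in> carrier_vec r" "v \<noteq> 0\<^sub>v r" "U *\<^sub>v v = 0\<^sub>v m"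
      using lin_depE[OF UD(1) _ \<open>distinct (cols U)\<close>] by blast
    have "v = (U\<^sup>T * U) *\<^sub>v v" unfolding UD(2) using v(1) by simp
    also have "\<dots> = U\<^sup>T *\<^sub>v (U *\<^sub>v v)" using UD(1) v(1) by (intro assoc_mult_mat_vec) auto
    also have "\<dots> = 0\<^sub>v r" unfolding v(3) using UD(1) by auto
    finally show False using v(2) by simp
  qed
  ultimately show ?thesis using lin_indpt_full_rank[OF UD(1)] by simp
qed

section \<open>Galerkin approximation\<close>

lemma lipschitz_bounded_fieldD:
  assumes "lipschitz_bounded_field m n F T L B" "t \<in> {0..T}" "Y \<in> carrier_mat m n"
  shows "F t Y \<in> carrier_mat m n" "frob_norm (F t Y) \<le> B"
    "Z \<in> carrier_mat m n \<Longrightarrow> frob_norm (F t Y - F t Z) \<le> L * frob_norm (Y - Z)"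
  using assms unfolding lipschitz_bounded_field_def by auto

lemma lipschitz_bounded_field_mono:
  assumes F: "lipschitz_bounded_field m n F T L B" and "L \<le> L'"
  shows "lipschitz_bounded_field m n F T L' B"
proof -
  have "frob_norm (F t Y - F t Z) \<le> L' * frob_norm (Y - Z)"
    if "t \<in> {0..T}" "Y \<in> carrier_mat m n" "Z \<in> carrier_mat m n" for t Y Z
    using lipschitz_bounded_fieldD(3)[OF F that] mult_right_mono[OF \<open>L \<le> L'\<close> frob_norm_nonneg[of "Y - Z"]]
    by linarith
  thus ?thesis using F unfolding lipschitz_bounded_field_def by blast
qed

lemma mat_drift_bound:
  assumes X: "has_mat_derivative p q X X' {a..b}"
    and bound: "\<And>t. t \<in> {a..b} \<Longrightarrow> frob_norm (X' t) \<le> B" and t: "t \<in> {a..b}"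
  shows "frob_norm (X t - X a) \<le> B * (b - a)"
proof -
  have "frob_norm (X t - X a) \<le> B * (t - a)"
    by (rule mat_mean_value_inequality[OF has_mat_derivative_subset[OF X]]) (use t bound in auto)
  also have "\<dots> \<le> B * (b - a)"
    using t bound[OF t] frob_norm_nonneg[of "X' t"] by (intro mult_left_mono) auto
  finally show ?thesis .
qed

text \<open>The small matrix equation for \<open>S\<close>, multiplied by the bases, is the projected equation for
  \<open>U S V\<^sup>T\<close>; since the bases contain \<open>U\<^sub>0\<close> and \<open>V\<^sub>0\<close>, no initial error is made.\<close>

lemma galerkin_step_lift:
  assumes step: "galerkin_step k F a b U0 S0 V0 U V Y" and "a \<le> b"
    and U: "orthonormal_cols m k U" and V: "orthonormal_cols n k V"
    and C0: "U0 \<in> carrier_mat m r" "S0 \<in> carrier_mat r r" "V0 \<in> carrier_mat n r"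
    and fixes0: "(U * U\<^sup>T) * U0 = U0" "(V * V\<^sup>T) * V0 = V0"
    and F: "\<And>t Z. t \<in> {a..b} \<Longrightarrow> Z \<in> carrier_mat m n \<Longrightarrow> F t Z \<in> carrier_mat m n"
  obtains X S where "has_mat_derivative m n X (\<lambda>t. galerkin_proj U V (F t (X t))) {a..b}"
    "X a = U0 * S0 * V0\<^sup>T" "X b = Y" "S \<in> carrier_mat k k" "Y = U * S * V\<^sup>T"
proof -
  note UC = orthonormal_colsD(1)[OF U] and VC = orthonormal_colsD(1)[OF V]
  obtain S where S: "has_mat_derivative k k S (\<lambda>t. U\<^sup>T * F t (U * S t * V\<^sup>T) * V) {a..b}"
      "S a = (U\<^sup>T * U0) * S0 * (V\<^sup>T * V0)\<^sup>T" "Y = U * S b * V\<^sup>T"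
    using step unfolding galerkin_step_def mat_solves_ivp_def by blast
  let ?X = "\<lambda>t. U * S t * V\<^sup>T"
  have SC: "S t \<in> carrier_mat k k" if "t \<in> {a..b}" for t
    using has_mat_derivativeD(1)[OF S(1) that] .
  have "has_mat_derivative m n ?X (\<lambda>t. U * (U\<^sup>T * F t (?X t) * V) * V\<^sup>T) {a..b}"
    using UC VC S(1) by (intro has_mat_derivative_mult_right has_mat_derivative_mult_left) auto
  hence d: "has_mat_derivative m n ?X (\<lambda>t. galerkin_proj U V (F t (?X t))) {a..b}"
  proof (rule has_mat_derivative_cong)
    fix t assume t: "t \<in> {a..b}"
    have "?X t \<in> carrier_mat m n" using UC VC SC[OF t] by auto
    thus "U * (U\<^sup>T * F t (?X t) * V) * V\<^sup>T = galerkin_proj U V (F t (?X t))"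
      using galerkin_proj_factored[OF U V F[OF t]] by simp
  qed simp
  let ?Y0 = "U0 * S0 * V0\<^sup>T"
  have US: "U0 * S0 \<in> carrier_mat m r" and V0T: "V0\<^sup>T \<in> carrier_mat r n" and UT: "U\<^sup>T \<in> carrier_mat k m"
    and Y0: "?Y0 \<in> carrier_mat m n"
    using C0 UC by auto
  have "(V\<^sup>T * V0)\<^sup>T = V0\<^sup>T * V" using transpose_mult[of "V\<^sup>T" k n V0 r] VC C0 by simp
  moreover have "(U\<^sup>T * U0) * S0 = U\<^sup>T * (U0 * S0)" using assoc_mult_mat[OF UT C0(1,2)] .
  moreover have "U\<^sup>T * (U0 * S0) * (V0\<^sup>T * V) = U\<^sup>T * (U0 * S0) * V0\<^sup>T * V"
    by (rule assoc_mult_mat[OF mult_carrier_mat[OF UT US] V0T VC, symmetric])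
  moreover have "U\<^sup>T * (U0 * S0) * V0\<^sup>T = U\<^sup>T * ?Y0" using assoc_mult_mat[OF UT US V0T] .
  ultimately have "S a = U\<^sup>T * ?Y0 * V" using S(2) by simp
  hence "?X a = galerkin_proj U V ?Y0" using galerkin_proj_factored[OF U V Y0] by simp
  also have "\<dots> = ?Y0" using C0 fixes0 by (intro galerkin_proj_fixes[OF U V]) auto
  finally show thesis using that[OF d _ _ SC S(3)] S(3) \<open>a \<le> b\<close> by auto
qed

text \<open>The difference \<open>Y - P A\<close> stays inside the projected space, where its growth is controlled by the
  Lipschitz constant and the defect of \<open>A\<close>; the part of the error outside that space is the defect at the
  end time.\<close>

lemma galerkin_error:
  assumes U: "orthonormal_cols m k U" and V: "orthonormal_cols n l V"
    and F: "lipschitz_bounded_field m n F T L B" and "0 \<le> L"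
    and I: "0 \<le> a" "a \<le> b" "b \<le> T"
    and A: "has_mat_derivative m n A (\<lambda>t. F t (A t)) {a..b}"
    and Y: "has_mat_derivative m n Y (\<lambda>t. galerkin_proj U V (F t (Y t))) {a..b}"
    and init: "Y a = A a" "galerkin_proj U V (A a) = A a"
    and defect: "\<And>t. t \<in> {a..b} \<Longrightarrow> frob_norm (A t - galerkin_proj U V (A t)) \<le> \<eta>"
  shows "frob_norm (Y b - A b) \<le>
    (b - a) * (L * (1 + exp (2 * L * (b - a))) * \<eta>) + frob_norm (A b - galerkin_proj U V (A b))"
proof -
  let ?P = "galerkin_proj U V"
  note [simp] = galerkin_proj_carrier[OF U V]
  have b: "b \<in> {a..b}" and a: "a \<in> {a..b}" using I by auto
  have AC: "A t \<in> carrier_mat m n" and YC: "Y t \<in> carrier_mat m n"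
    and FA: "F t (A t) \<in> carrier_mat m n" and FY: "F t (Y t) \<in> carrier_mat m n"
    and t0T: "t \<in> {0..T}" if "t \<in> {a..b}" for t
    using has_mat_derivativeD(1)[OF A that] has_mat_derivativeD(1)[OF Y that] that I
      lipschitz_bounded_fieldD(1)[OF F] by auto
  have "0 \<le> \<eta>" using defect[OF b] frob_norm_nonneg[of "A b - ?P (A b)"] by linarith
  have "frob_norm (Y b - ?P (A b)) \<le> (b - a) * (L * (1 + exp (2 * L * (b - a))) * \<eta>)"
  proof (rule mat_gronwall[where X = "\<lambda>t. Y t - ?P (A t)"])
    show "has_mat_derivative m n (\<lambda>t. Y t - ?P (A t)) (\<lambda>t. ?P (F t (Y t)) - ?P (F t (A t))) {a..b}"
      by (intro has_mat_derivative_minus Y has_mat_derivative_galerkin_proj[OF U V] A)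
    show "Y a - ?P (A a) = 0\<^sub>m m n" using init AC[OF a] by (intro eq_matI) auto
    fix t assume t: "t \<in> {a..b}"
    have "frob_norm (?P (F t (Y t)) - ?P (F t (A t))) = frob_norm (?P (F t (Y t) - F t (A t)))"
      using galerkin_proj_minus[OF U V FY[OF t] FA[OF t]] by simp
    also have "\<dots> \<le> frob_norm (F t (Y t) - F t (A t))"
      using FA[OF t] by (intro frob_norm_galerkin_proj_le[OF U V]) simp
    also have "\<dots> \<le> L * frob_norm (Y t - A t)"
      by (rule lipschitz_bounded_fieldD(3)[OF F t0T[OF t] YC[OF t] AC[OF t]])
    also have "\<dots> \<le> L * (frob_norm (Y t - ?P (A t)) + \<eta>)"
    proof (rule mult_left_mono[OF _ \<open>0 \<le> L\<close>])
      have "frob_norm (Y t - A t) \<le> frob_norm (Y t - ?P (A t)) + frob_norm (?P (A t) - A t)"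
        by (rule frob_norm_triangle[where p = m and q = n]) (use YC AC t in auto)
      thus "frob_norm (Y t - A t) \<le> frob_norm (Y t - ?P (A t)) + \<eta>"
        using defect[OF t] frob_norm_minus_commute[OF AC[OF t], of "?P (A t)"] by simp
    qed
    finally show "frob_norm (?P (F t (Y t)) - ?P (F t (A t))) \<le> L * (frob_norm (Y t - ?P (A t)) + \<eta>)" .
  qed (use \<open>0 \<le> L\<close> \<open>0 \<le> \<eta>\<close> I in auto)
  moreover have "frob_norm (Y b - A b) \<le> frob_norm (Y b - ?P (A b)) + frob_norm (?P (A b) - A b)"
    by (rule frob_norm_triangle[where p = m and q = n]) (use YC AC b in auto)
  moreover have "frob_norm (?P (A b) - A b) = frob_norm (A b - ?P (A b))"
    by (rule frob_norm_minus_commute[OF _ AC[OF b]]) simp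
  ultimately show ?thesis by linarith
qed

section \<open>Accuracy of the augmented bases\<close>

text \<open>Both \<open>X\<close> and \<open>A\<close> stay within \<open>B (b - a)\<close> of their common initial value, hence \<open>F(t, X)\<close> and \<open>F(t, A)\<close>
  differ by at most \<open>2 L B (b - a)\<close>, and so do the derivatives of \<open>X\<close> and \<open>P A\<close>.\<close>

lemma projected_flow_increment:
  assumes U: "orthonormal_cols m k U" and V: "orthonormal_cols n l V"
    and F: "lipschitz_bounded_field m n F T L B" and "0 \<le> L"
    and I: "0 \<le> a" "a \<le> b" "b \<le> T"
    and A: "has_mat_derivative m n A (\<lambda>t. F t (A t)) {a..b}"
    and X: "has_mat_derivative m n X (\<lambda>t. galerkin_proj U V (F t (X t))) {a..b}"
    and init: "X a = A a"
  shows "frob_norm (galerkin_proj U V (A b - A a) - (X b - A a)) \<le> 2 * L * B * (b - a)\<^sup>2"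
proof -
  let ?P = "galerkin_proj U V"
  note [simp] = galerkin_proj_carrier[OF U V]
  have ab: "a \<in> {a..b}" "b \<in> {a..b}" using I by auto
  have AC: "A t \<in> carrier_mat m n" and XC: "X t \<in> carrier_mat m n"
    and FA: "F t (A t) \<in> carrier_mat m n" "frob_norm (F t (A t)) \<le> B"
    and FX: "F t (X t) \<in> carrier_mat m n" "frob_norm (F t (X t)) \<le> B"
    and t0T: "t \<in> {0..T}" if "t \<in> {a..b}" for t
    using has_mat_derivativeD(1)[OF A that] has_mat_derivativeD(1)[OF X that] that I
      lipschitz_bounded_fieldD(1,2)[OF F] by auto
  have PFX: "frob_norm (?P (F t (X t))) \<le> B" if "t \<in> {a..b}" for t
    using frob_norm_galerkin_proj_le[OF U V FX(1)[OF that]] FX(2)[OF that] by linarith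
  have "frob_norm ((?P (A b) - X b) - (?P (A a) - X a)) \<le> 2 * L * B * (b - a) * (b - a)"
  proof (rule mat_mean_value_inequality[where X = "\<lambda>t. ?P (A t) - X t", OF _ \<open>a \<le> b\<close>])
    show "has_mat_derivative m n (\<lambda>t. ?P (A t) - X t) (\<lambda>t. ?P (F t (A t)) - ?P (F t (X t))) {a..b}"
      by (intro has_mat_derivative_minus X has_mat_derivative_galerkin_proj[OF U V] A)
    fix t assume t: "t \<in> {a..b}"
    have "frob_norm (?P (F t (A t)) - ?P (F t (X t))) = frob_norm (?P (F t (A t) - F t (X t)))"
      using galerkin_proj_minus[OF U V FA(1)[OF t] FX(1)[OF t]] by simp
    also have "\<dots> \<le> frob_norm (F t (A t) - F t (X t))"
      using FX(1)[OF t] by (intro frob_norm_galerkin_proj_le[OF U V]) simp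
    also have "\<dots> \<le> L * frob_norm (A t - X t)"
      by (rule lipschitz_bounded_fieldD(3)[OF F t0T[OF t] AC[OF t] XC[OF t]])
    also have "\<dots> \<le> L * (2 * B * (b - a))"
    proof (rule mult_left_mono[OF _ \<open>0 \<le> L\<close>])
      have "frob_norm (A t - X t) \<le> frob_norm (A t - A a) + frob_norm (A a - X t)"
        by (rule frob_norm_triangle[OF AC[OF t] AC[OF ab(1)] XC[OF t]])
      moreover have "frob_norm (A a - X t) = frob_norm (X t - X a)"
        unfolding init by (rule frob_norm_minus_commute[OF AC[OF ab(1)] XC[OF t]])
      ultimately show "frob_norm (A t - X t) \<le> 2 * B * (b - a)"
        using mat_drift_bound[OF A FA(2) t] mat_drift_bound[OF X PFX t] by linarith
    qed
    finally show "frob_norm (?P (F t (A t)) - ?P (F t (X t))) \<le> 2 * L * B * (b - a)"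
      by (simp add: ac_simps)
  qed
  also have "(?P (A b) - X b) - (?P (A a) - X a) = ?P (A b - A a) - (X b - A a)"
    unfolding galerkin_proj_minus[OF U V AC[OF ab(2)] AC[OF ab(1)]] init
    using AC[OF ab(1)] XC[OF ab(2)] carrier_matD[OF galerkin_proj_carrier[OF U V]]
    by (intro eq_matI) auto
  finally show ?thesis by (simp add: power2_eq_square mult.assoc)
qed

lemma galerkin_proj_one_left: "Z \<in> carrier_mat m n \<Longrightarrow> galerkin_proj (1\<^sub>m m) V Z = Z * (V * V\<^sup>T)"
  unfolding galerkin_proj_def by simp

lemma galerkin_proj_one_right:
  assumes "U \<in> carrier_mat m k" "Z \<in> carrier_mat m n"
  shows "galerkin_proj U (1\<^sub>m n) Z = U * U\<^sup>T * Z"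
proof -
  have "U * U\<^sup>T * Z \<in> carrier_mat m n" using assms by auto
  thus ?thesis unfolding galerkin_proj_def using right_mult_one_mat[of "U * U\<^sup>T * Z"] by simp
qed

text \<open>Let \<open>G = A(b) - A(a)\<close>, \<open>P = U\<^sub>0 U\<^sub>0\<^sup>T\<close>, \<open>Q = V\<^sub>0 V\<^sub>0\<^sup>T\<close>.  In \<open>G = P\<^sup>\<bottom>G + G Q + P G - P G Q\<close> the normal part is
  small by assumption, \<open>G Q\<close> and \<open>P G\<close> are close to the increments of \<open>K V\<^sub>0\<^sup>T\<close> and \<open>U\<^sub>0 L\<^sup>T\<close>, which the
  augmented bases contain, and \<open>P G Q\<close> is contained exactly.  The Lipschitz
  condition compares \<open>F(t, A(t))\<close> with \<open>F(t, A(a))\<close> at the same time, which is why the normal component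
  at \<open>A(a)\<close> has to be small for all times of the step.\<close>

lemma augmented_basis_defect:
  assumes F: "lipschitz_bounded_field m n F T L B" and "0 \<le> L"
    and I: "0 \<le> a" "a \<le> b" "b \<le> T"
    and A: "has_mat_derivative m n A (\<lambda>t. F t (A t)) {a..b}"
    and f: "low_rank_factors m n r (A a) U0 S0 V0"
    and normal: "\<And>t. t \<in> {a..b} \<Longrightarrow> frob_norm (normal_proj U0 V0 (F t (A a))) \<le> \<epsilon>"
    and K: "mat_solves_ivp m r (\<lambda>t X. F t (X * V0\<^sup>T) * V0) a b (U0 * S0) K"
    and Lf: "mat_solves_ivp n r (\<lambda>t X. (F t (U0 * X\<^sup>T))\<^sup>T * U0) a b (V0 * S0\<^sup>T) Lf"
    and U: "orthonormal_cols m k U" "(U * U\<^sup>T) * U0 = U0" "(U * U\<^sup>T) * K b = K b"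
    and V: "orthonormal_cols n l V" "(V * V\<^sup>T) * V0 = V0" "(V * V\<^sup>T) * Lf b = Lf b"
  shows "frob_norm (A b - galerkin_proj U V (A b)) \<le> (b - a) * \<epsilon> + 5 * L * B * (b - a)\<^sup>2"
proof -
  have ab: "a \<in> {a..b}" "b \<in> {a..b}" using I by auto
  have AC: "A t \<in> carrier_mat m n"
    and FA: "F t (A t) \<in> carrier_mat m n" "frob_norm (F t (A t)) \<le> B"
    and FX: "\<And>X. X \<in> carrier_mat m n \<Longrightarrow> F t X \<in> carrier_mat m n"
    and t0T: "t \<in> {0..T}" if "t \<in> {a..b}" for t
    using has_mat_derivativeD(1)[OF A that] that I lipschitz_bounded_fieldD(1,2)[OF F] by auto
  have U0: "orthonormal_cols m r U0" and V0: "orthonormal_cols n r V0" and S0: "S0 \<in> carrier_mat r r"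
    and Y0: "A a = U0 * S0 * V0\<^sup>T"
    using f unfolding low_rank_factors_def by auto
  note UD = orthonormal_colsD[OF U0] and VD = orthonormal_colsD[OF V0]
  note gc = galerkin_proj_carrier[OF U(1) V(1)]
  let ?P = "galerkin_proj U V"
  let ?G = "A b - A a"
  have GC: "?G \<in> carrier_mat m n" using AC[OF ab(1)] by simp
  have Kd: "has_mat_derivative m r K (\<lambda>t. F t (K t * V0\<^sup>T) * V0) {a..b}" and Ka: "K a = U0 * S0"
    using K unfolding mat_solves_ivp_def by auto
  have Ld: "has_mat_derivative n r Lf (\<lambda>t. (F t (U0 * (Lf t)\<^sup>T))\<^sup>T * U0) {a..b}" and La: "Lf a = V0 * S0\<^sup>T"
    using Lf unfolding mat_solves_ivp_def by auto
  define X where "X t = K t * V0\<^sup>T" for t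
  define Z where "Z t = U0 * (Lf t)\<^sup>T" for t
  have XC: "X t \<in> carrier_mat m n" and ZC: "Z t \<in> carrier_mat m n" if "t \<in> {a..b}" for t
    using has_mat_derivativeD(1)[OF Kd that] has_mat_derivativeD(1)[OF Ld that] UD(1) VD(1)
    unfolding X_def Z_def by auto
  have Xd: "has_mat_derivative m n X (\<lambda>t. galerkin_proj (1\<^sub>m m) V0 (F t (X t))) {a..b}"
  proof (rule has_mat_derivative_cong)
    show "has_mat_derivative m n (\<lambda>t. K t * V0\<^sup>T) (\<lambda>t. F t (K t * V0\<^sup>T) * V0 * V0\<^sup>T) {a..b}"
      using VD(1) Kd by (intro has_mat_derivative_mult_right) auto
    show "F t (K t * V0\<^sup>T) * V0 * V0\<^sup>T = galerkin_proj (1\<^sub>m m) V0 (F t (X t))" if t: "t \<in> {a..b}" for t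
      using galerkin_proj_one_left[OF FX[OF t XC[OF t]]] FX[OF t XC[OF t]] VD(1)
        assoc_mult_mat[of "F t (X t)" m n V0 r "V0\<^sup>T" n] unfolding X_def by simp
  qed (simp add: X_def)
  have Zd: "has_mat_derivative m n Z (\<lambda>t. galerkin_proj U0 (1\<^sub>m n) (F t (Z t))) {a..b}"
  proof (rule has_mat_derivative_cong)
    show "has_mat_derivative m n (\<lambda>t. U0 * (Lf t)\<^sup>T) (\<lambda>t. U0 * ((F t (U0 * (Lf t)\<^sup>T))\<^sup>T * U0)\<^sup>T) {a..b}"
      by (rule has_mat_derivative_mult_left[OF UD(1) has_mat_derivative_transpose[OF Ld]])
    fix t assume t: "t \<in> {a..b}"
    note FZ = FX[OF t ZC[OF t]]
    have "U0 * ((F t (Z t))\<^sup>T * U0)\<^sup>T = U0 * (U0\<^sup>T * F t (Z t))"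
      using transpose_mult[of "(F t (Z t))\<^sup>T" n m U0 r] FZ UD(1) by simp
    also have "\<dots> = U0 * U0\<^sup>T * F t (Z t)"
      using assoc_mult_mat[of U0 m r "U0\<^sup>T" m "F t (Z t)" n] FZ UD(1) by simp
    finally show "U0 * ((F t (U0 * (Lf t)\<^sup>T))\<^sup>T * U0)\<^sup>T = galerkin_proj U0 (1\<^sub>m n) (F t (Z t))"
      using galerkin_proj_one_right[OF UD(1) FZ] unfolding Z_def by simp
  qed (simp add: Z_def)
  have Xa: "X a = A a" unfolding X_def Ka Y0 ..
  have Za: "Z a = A a"
    using transpose_mult[OF VD(1), of "S0\<^sup>T" r] assoc_mult_mat[OF UD(1) S0, of "V0\<^sup>T" n] S0 VD(1)
    unfolding Z_def La Y0 by simp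
  note dX = projected_flow_increment[OF orthonormal_cols_one V0 F \<open>0 \<le> L\<close> I A Xd Xa]
  note dZ = projected_flow_increment[OF U0 orthonormal_cols_one F \<open>0 \<le> L\<close> I A Zd Za]
  have dN: "frob_norm (normal_proj U0 V0 ?G) \<le> (\<epsilon> + L * B * (b - a)) * (b - a)"
  proof -
    have "frob_norm (normal_proj U0 V0 (A b) - normal_proj U0 V0 (A a)) \<le> (\<epsilon> + L * B * (b - a)) * (b - a)"
    proof (rule mat_mean_value_inequality[OF has_mat_derivative_normal_proj[OF U0 V0 A] I(2)])
      fix t assume t: "t \<in> {a..b}"
      note F0 = FX[OF t AC[OF ab(1)]]
      have "frob_norm (normal_proj U0 V0 (F t (A t))) \<le> frob_norm (normal_proj U0 V0 (F t (A a))) +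
          frob_norm (normal_proj U0 V0 (F t (A t)) - normal_proj U0 V0 (F t (A a)))"
        by (intro frob_norm_le_add_minus[where p = m and q = n] normal_proj_carrier[OF UD(1) VD(1)] FA(1)[OF t] F0)
      moreover have "frob_norm (normal_proj U0 V0 (F t (A t)) - normal_proj U0 V0 (F t (A a)))
          \<le> frob_norm (F t (A t) - F t (A a))"
        unfolding normal_proj_minus[OF U0 V0 FA(1)[OF t] F0, symmetric]
        using F0 by (intro frob_norm_normal_proj_le[OF U0 V0]) simp
      moreover have "frob_norm (F t (A t) - F t (A a)) \<le> L * frob_norm (A t - A a)"
        by (rule lipschitz_bounded_fieldD(3)[OF F t0T[OF t] AC[OF t] AC[OF ab(1)]])
      moreover have "L * frob_norm (A t - A a) \<le> L * (B * (b - a))"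
        by (rule mult_left_mono[OF mat_drift_bound[OF A FA(2) t] \<open>0 \<le> L\<close>])
      ultimately show "frob_norm (normal_proj U0 V0 (F t (A t))) \<le> \<epsilon> + L * B * (b - a)"
        using normal[OF t] by (simp add: mult.assoc)
    qed
    thus ?thesis using normal_proj_minus[OF U0 V0 AC[OF ab(2)] AC[OF ab(1)]] by simp
  qed
  let ?G1 = "galerkin_proj (1\<^sub>m m) V0 ?G"
  let ?G2 = "galerkin_proj U0 (1\<^sub>m n) ?G"
  let ?G12 = "galerkin_proj U0 V0 ?G"
  have G1: "?G1 \<in> carrier_mat m n" and G2: "?G2 \<in> carrier_mat m n" and G12: "?G12 \<in> carrier_mat m n"
    using galerkin_proj_carrier[OF orthonormal_cols_one V0] galerkin_proj_carrier[OF U0 orthonormal_cols_one]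
      galerkin_proj_carrier[OF U0 V0] by auto
  \<comment> \<open>The approximation of \<open>A b\<close> that the augmented bases reproduce exactly.\<close>
  let ?C = "X b + Z b - A a - ?G12"
  note Xb = XC[OF ab(2)] and Zb = ZC[OF ab(2)] and Aa = AC[OF ab(1)] and Ab = AC[OF ab(2)]
  have Kb: "K b \<in> carrier_mat m r" and Lb: "Lf b \<in> carrier_mat n r"
    using has_mat_derivativeD(1)[OF Kd ab(2)] has_mat_derivativeD(1)[OF Ld ab(2)] .
  have "?P (K b * 1\<^sub>m r * V0\<^sup>T) = K b * 1\<^sub>m r * V0\<^sup>T"
    by (rule galerkin_proj_fixes[OF U(1) V(1) U(3) Kb V(2) VD(1)]) simp
  hence PX: "?P (X b) = X b" using Kb unfolding X_def by simp
  have "?P (U0 * 1\<^sub>m r * (Lf b)\<^sup>T) = U0 * 1\<^sub>m r * (Lf b)\<^sup>T"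
    by (rule galerkin_proj_fixes[OF U(1) V(1) U(2) UD(1) V(3) Lb]) simp
  hence PZ: "?P (Z b) = Z b" using UD(1) unfolding Z_def by simp
  have PA: "?P (A a) = A a"
    unfolding Y0 by (rule galerkin_proj_fixes[OF U(1) V(1) U(2) UD(1) V(2) VD(1) S0])
  have PG: "?P ?G12 = ?G12"
    unfolding galerkin_proj_factored[OF U0 V0 GC]
    by (rule galerkin_proj_fixes[OF U(1) V(1) U(2) UD(1) V(2) VD(1)]) (use UD(1) VD(1) GC in auto)
  have "?P ?C = ?C"
    using galerkin_proj_minus[OF U(1) V(1), of "X b + Z b - A a" ?G12] galerkin_proj_minus[OF U(1) V(1), of "X b + Z b" "A a"]
      galerkin_proj_add[OF U(1) V(1) Xb Zb] PX PZ PA PG Xb Zb Aa G12 by simp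
  hence "frob_norm (A b - ?P (A b)) \<le> frob_norm (A b - ?C)"
    by (intro galerkin_proj_best_approx[OF U(1) V(1) Ab]) (use G12 in simp)
  also have "A b - ?C = normal_proj U0 V0 ?G + ((?G1 - (X b - A a)) + (?G2 - (Z b - A a)))"
  proof -
    have "normal_proj U0 V0 ?G = ?G - (?G1 - ?G12 + ?G2)"
      unfolding normal_proj_def tangent_proj_def galerkin_proj_one_left[OF GC]
        galerkin_proj_one_right[OF UD(1) GC] galerkin_proj_def[of U0 V0] ..
    moreover have "A b - ?C = (?G - (?G1 - ?G12 + ?G2)) + ((?G1 - (X b - A a)) + (?G2 - (Z b - A a)))"
      using carrier_matD[OF G1] carrier_matD[OF G2] carrier_matD[OF G12] Xb Zb Aa Ab
      by (intro eq_matI) auto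
    ultimately show ?thesis by simp
  qed
  also have "frob_norm \<dots> \<le> frob_norm (normal_proj U0 V0 ?G) +
      (frob_norm (?G1 - (X b - A a)) + frob_norm (?G2 - (Z b - A a)))"
  proof -
    have c1: "?G1 - (X b - A a) \<in> carrier_mat m n" and c2: "?G2 - (Z b - A a) \<in> carrier_mat m n"
      using Aa by auto
    show ?thesis
      using frob_norm_add_le[OF normal_proj_carrier[OF UD(1) VD(1) GC] add_carrier_mat[OF c2, of "?G1 - (X b - A a)"]]
        frob_norm_add_le[OF c1 c2] by linarith
  qed
  also have "\<dots> \<le> (b - a) * \<epsilon> + 5 * L * B * (b - a)\<^sup>2"
    using dN dX dZ by (simp add: power2_eq_square algebra_simps)
  finally show ?thesis .
qed

text \<open>The bound is assumed on matrices of rank exactly \<open>k\<close>, but the middle factor computed by a Galerkin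
  step may be singular.  The bases \<open>U\<close> and \<open>V\<close>, and hence the projection, do not change when that
  factor is perturbed to an invertible one, so the bound extends by continuity.\<close>

lemma normal_component_bound_factored:
  assumes N: "normal_component_bound m n k F T A \<rho> \<epsilon>" and t: "t \<in> {0..T}" and At: "A t \<in> carrier_mat m n"
    and F: "lipschitz_bounded_field m n F T L B" and "0 \<le> L"
    and U: "orthonormal_cols m k U" and V: "orthonormal_cols n k V" and S: "S \<in> carrier_mat k k"
    and near: "frob_norm (U * S * V\<^sup>T - A t) < \<rho>"
  shows "frob_norm (normal_proj U V (F t (U * S * V\<^sup>T))) \<le> \<epsilon>"
proof (rule field_le_epsilon)
  fix e :: real assume "0 < e"
  note UC = orthonormal_colsD(1)[OF U] and VC = orthonormal_colsD(1)[OF V]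
  let ?Y = "U * S * V\<^sup>T"
  \<comment> \<open>The summand \<open>1\<close> keeps \<open>\<kappa>\<close> positive when \<open>k = 0\<close>.\<close>
  define \<kappa> where "\<kappa> = frob_norm (U * V\<^sup>T) + 1"
  have \<kappa>: "0 < \<kappa>" "frob_norm (U * V\<^sup>T) \<le> \<kappa>" using frob_norm_nonneg[of "U * V\<^sup>T"] unfolding \<kappa>_def by auto
  \<comment> \<open>The first bound on the shift keeps the perturbed matrix in the neighbourhood, the second makes
  the change of the field smaller than \<open>e\<close>.\<close>
  have "0 < min ((\<rho> - frob_norm (?Y - A t)) / \<kappa>) (e / ((L + 1) * \<kappa>))"
    using near \<kappa> \<open>0 < e\<close> \<open>0 \<le> L\<close> by simp
  then obtain d where d: "0 < d" "d < min ((\<rho> - frob_norm (?Y - A t)) / \<kappa>) (e / ((L + 1) * \<kappa>))"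
    and inv: "invertible_mat (S + d \<cdot>\<^sub>m 1\<^sub>m k)"
    using invertible_shift_near_zero[OF S] by metis
  have d1: "d * \<kappa> < \<rho> - frob_norm (?Y - A t)" and d2: "d * ((L + 1) * \<kappa>) < e"
    using d \<kappa> \<open>0 \<le> L\<close> by (auto simp: pos_less_divide_eq)
  let ?S = "S + d \<cdot>\<^sub>m 1\<^sub>m k"
  let ?Yd = "U * ?S * V\<^sup>T"
  have SC: "?S \<in> carrier_mat k k" using S by simp
  have YC: "?Y \<in> carrier_mat m n" and YdC: "?Yd \<in> carrier_mat m n" using UC VC S SC by auto
  have diff: "frob_norm (?Yd - ?Y) \<le> d * \<kappa>"
  proof -
    have US: "U * S \<in> carrier_mat m k" and dU: "d \<cdot>\<^sub>m U \<in> carrier_mat m k" and VT: "V\<^sup>T \<in> carrier_mat k n"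
      using UC S VC by auto
    have "U * ?S = U * S + U * (d \<cdot>\<^sub>m 1\<^sub>m k)"
      by (rule mult_add_distrib_mat[OF UC S]) simp
    also have "U * (d \<cdot>\<^sub>m 1\<^sub>m k) = d \<cdot>\<^sub>m U"
      using mult_smult_distrib[OF UC, of "1\<^sub>m k" k d] UC by simp
    finally have "?Yd = ?Y + d \<cdot>\<^sub>m U * V\<^sup>T"
      using add_mult_distrib_mat[OF US dU VT] by simp
    also have "d \<cdot>\<^sub>m U * V\<^sup>T = d \<cdot>\<^sub>m (U * V\<^sup>T)"
      by (rule mult_smult_assoc_mat[OF UC VT])
    finally have "?Yd - ?Y = d \<cdot>\<^sub>m (U * V\<^sup>T)" using YC UC VC by (intro eq_matI) auto
    thus ?thesis using \<kappa> d(1) by (simp add: frob_norm_smult)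
  qed
  have lr: "low_rank_factors m n k ?Yd U ?S V"
    unfolding low_rank_factors_def using U V SC inv by simp
  have "frob_norm (?Yd - A t) < \<rho>"
    using frob_norm_triangle[OF YdC YC At] diff d1 by linarith
  hence Nd: "frob_norm (normal_proj U V (F t ?Yd)) \<le> \<epsilon>"
    using N t lr rank_low_rank_factors[OF lr] YdC
    unfolding normal_component_bound_def rank_manifold_def by blast
  note FY = lipschitz_bounded_fieldD(1)[OF F t YC] and FYd = lipschitz_bounded_fieldD(1)[OF F t YdC]
  have "frob_norm (normal_proj U V (F t ?Y)) \<le> frob_norm (normal_proj U V (F t ?Yd)) +
      frob_norm (normal_proj U V (F t ?Y) - normal_proj U V (F t ?Yd))"
    by (intro frob_norm_le_add_minus[where p = m and q = n] normal_proj_carrier[OF UC VC] FY FYd)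
  moreover have "frob_norm (normal_proj U V (F t ?Y) - normal_proj U V (F t ?Yd)) \<le> frob_norm (F t ?Y - F t ?Yd)"
    unfolding normal_proj_minus[OF U V FY FYd, symmetric]
    using FYd by (intro frob_norm_normal_proj_le[OF U V]) simp
  moreover have "frob_norm (F t ?Y - F t ?Yd) \<le> L * frob_norm (?Y - ?Yd)"
    by (rule lipschitz_bounded_fieldD(3)[OF F t YC YdC])
  moreover have "L * frob_norm (?Y - ?Yd) \<le> L * (d * \<kappa>)"
    using diff frob_norm_minus_commute[OF YC YdC] \<open>0 \<le> L\<close> by (intro mult_left_mono) auto
  moreover have "L * (d * \<kappa>) \<le> e"
    using d2 mult_pos_pos[OF d(1) \<kappa>(1)] by (simp add: algebra_simps)
  ultimately show "frob_norm (normal_proj U V (F t ?Y)) \<le> \<epsilon> + e" using Nd by linarith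
qed

text \<open>The tangential part of \<open>Z\<close> is \<open>(Z Vh) Vh\<^sup>T - Uh (\<dots>) Vh\<^sup>T + Uh (Z\<^sup>T Uh)\<^sup>T\<close>, and each term
  has its left and right factors in the ranges of the enlarged bases.  This is the reason for the
  blocks by which the second step augments its bases.\<close>

lemma augmented_basis_captures_tangent:
  assumes Uh: "orthonormal_cols m k Uh" and Vh: "orthonormal_cols n l Vh" and Z: "Z \<in> carrier_mat m n"
    and U: "orthonormal_cols m k' U" "(U * U\<^sup>T) * Uh = Uh" "(U * U\<^sup>T) * (Z * Vh) = Z * Vh"
    and V: "orthonormal_cols n l' V" "(V * V\<^sup>T) * Vh = Vh" "(V * V\<^sup>T) * (Z\<^sup>T * Uh) = Z\<^sup>T * Uh"
  shows "tangent_proj Uh Vh Z \<in> carrier_mat m n"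
    and "galerkin_proj U V (tangent_proj Uh Vh Z) = tangent_proj Uh Vh Z"
proof -
  note UC = orthonormal_colsD(1)[OF Uh] and VC = orthonormal_colsD(1)[OF Vh]
  let ?P = "galerkin_proj U V"
  have ZV: "Z * Vh \<in> carrier_mat m l" and ZU: "Z\<^sup>T * Uh \<in> carrier_mat n k" using Z UC VC by auto
  have "?P (Z * Vh * 1\<^sub>m l * Vh\<^sup>T) = Z * Vh * 1\<^sub>m l * Vh\<^sup>T"
    by (rule galerkin_proj_fixes[OF U(1) V(1) U(3) ZV V(2) VC]) simp
  moreover have "Z * Vh * 1\<^sub>m l * Vh\<^sup>T = Z * (Vh * Vh\<^sup>T)"
    using assoc_mult_mat[OF Z VC, of "Vh\<^sup>T" n] right_mult_one_mat[OF ZV] VC by simp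
  ultimately have r: "?P (Z * (Vh * Vh\<^sup>T)) = Z * (Vh * Vh\<^sup>T)" by simp
  have "?P (Uh * 1\<^sub>m k * (Z\<^sup>T * Uh)\<^sup>T) = Uh * 1\<^sub>m k * (Z\<^sup>T * Uh)\<^sup>T"
    by (rule galerkin_proj_fixes[OF U(1) V(1) U(2) UC V(3) ZU]) simp
  moreover have "Uh * 1\<^sub>m k * (Z\<^sup>T * Uh)\<^sup>T = Uh * Uh\<^sup>T * Z"
    using transpose_mult[of "Z\<^sup>T" n m Uh k] assoc_mult_mat[OF UC _ Z, of "Uh\<^sup>T"] Z UC by simp
  ultimately have l: "?P (Uh * Uh\<^sup>T * Z) = Uh * Uh\<^sup>T * Z" by simp
  have "?P (galerkin_proj Uh Vh Z) = galerkin_proj Uh Vh Z"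
    unfolding galerkin_proj_factored[OF Uh Vh Z]
    by (rule galerkin_proj_fixes[OF U(1) V(1) U(2) UC V(2) VC]) (use UC VC Z in auto)
  hence c: "?P (Uh * Uh\<^sup>T * Z * (Vh * Vh\<^sup>T)) = Uh * Uh\<^sup>T * Z * (Vh * Vh\<^sup>T)"
    unfolding galerkin_proj_def[of Uh Vh] .
  have C: "Z * (Vh * Vh\<^sup>T) \<in> carrier_mat m n" "Uh * Uh\<^sup>T * Z \<in> carrier_mat m n"
    "Uh * Uh\<^sup>T * Z * (Vh * Vh\<^sup>T) \<in> carrier_mat m n" using UC VC Z by auto
  show "tangent_proj Uh Vh Z \<in> carrier_mat m n"
    unfolding tangent_proj_def using C by simp
  show "?P (tangent_proj Uh Vh Z) = tangent_proj Uh Vh Z"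
    unfolding tangent_proj_def
    using galerkin_proj_add[OF U(1) V(1) _ C(2), of "Z * (Vh * Vh\<^sup>T) - Uh * Uh\<^sup>T * Z * (Vh * Vh\<^sup>T)"]
      galerkin_proj_minus[OF U(1) V(1) C(1,3)] C r l c by simp
qed

section \<open>Local error of the midpoint integrator\<close>

text \<open>On the half step the crude defect bound \<open>B (b - a)\<close> suffices inside the interval, since the Galerkin
  estimate multiplies it by \<open>b - a\<close>; only the end point needs the refined bound.\<close>

lemma half_step_accuracy:
  assumes F: "lipschitz_bounded_field m n F T L B" and "0 \<le> L"
    and I: "0 \<le> a" "a \<le> b" "b \<le> T"
    and A: "has_mat_derivative m n A (\<lambda>t. F t (A t)) {a..b}"
    and f: "low_rank_factors m n r (A a) U0 S0 V0"
    and normal: "\<forall>t\<in>{a..b}. frob_norm (normal_proj U0 V0 (F t (A a))) \<le> \<epsilon>"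
    and step: "augmented_bug_step m n r k F a b U0 S0 V0 U V Y"
  defines "\<delta> \<equiv> (b - a) * \<epsilon> + 5 * L * B * (b - a)\<^sup>2"
  shows "orthonormal_cols m k U" "orthonormal_cols n k V"
    and "(U * U\<^sup>T) * U0 = U0" "(V * V\<^sup>T) * V0 = V0"
    and "\<exists>S. S \<in> carrier_mat k k \<and> Y = U * S * V\<^sup>T"
    and "frob_norm (Y - A a) \<le> B * (b - a)"
    and "frob_norm (A b - galerkin_proj U V (A b)) \<le> \<delta>"
    and "frob_norm (Y - A b) \<le> L * (1 + exp (2 * L * (b - a))) * B * (b - a)\<^sup>2 + \<delta>"
proof -
  have ab: "a \<in> {a..b}" "b \<in> {a..b}" using I by auto
  have U0: "orthonormal_cols m r U0" and V0: "orthonormal_cols n r V0" and S0: "S0 \<in> carrier_mat r r"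
    and Y0: "A a = U0 * S0 * V0\<^sup>T"
    using f unfolding low_rank_factors_def by auto
  note UD = orthonormal_colsD(1)[OF U0] and VD = orthonormal_colsD(1)[OF V0]
  obtain K where K: "mat_solves_ivp m r (\<lambda>t X. F t (X * V0\<^sup>T) * V0) a b (U0 * S0) K"
      and KU: "is_orth m k (hcat m U0 (K b)) U"
    using step unfolding augmented_bug_step_def by blast
  obtain Lf where Lf: "mat_solves_ivp n r (\<lambda>t X. (F t (U0 * X\<^sup>T))\<^sup>T * U0) a b (V0 * S0\<^sup>T) Lf"
      and LV: "is_orth n k (hcat n V0 (Lf b)) V"
    using step unfolding augmented_bug_step_def by blast
  have g: "galerkin_step k F a b U0 S0 V0 U V Y"
    using step unfolding augmented_bug_step_def by blast
  show U: "orthonormal_cols m k U" and V: "orthonormal_cols n k V"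
    using KU LV unfolding is_orth_def by auto
  have Kb: "K b \<in> carrier_mat m r" and Lb: "Lf b \<in> carrier_mat n r"
    using K Lf ab unfolding mat_solves_ivp_def has_mat_derivative_def by auto
  show UU0: "(U * U\<^sup>T) * U0 = U0" and VV0: "(V * V\<^sup>T) * V0 = V0"
    using is_orth_hcat_fixes(1)[OF KU UD Kb] is_orth_hcat_fixes(1)[OF LV VD Lb] .
  show defect: "frob_norm (A b - galerkin_proj U V (A b)) \<le> \<delta>"
    unfolding \<delta>_def
    by (rule augmented_basis_defect[OF F \<open>0 \<le> L\<close> I A f bspec[OF normal] K Lf U UU0
      is_orth_hcat_fixes(2)[OF KU UD Kb] V VV0 is_orth_hcat_fixes(2)[OF LV VD Lb]])
  have AC: "A t \<in> carrier_mat m n" and FX: "\<And>X. X \<in> carrier_mat m n \<Longrightarrow> F t X \<in> carrier_mat m n"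
    and FB: "\<And>X. X \<in> carrier_mat m n \<Longrightarrow> frob_norm (F t X) \<le> B" if "t \<in> {a..b}" for t
    using has_mat_derivativeD(1)[OF A that] that I lipschitz_bounded_fieldD(1,2)[OF F] by auto
  obtain X S where X: "has_mat_derivative m n X (\<lambda>t. galerkin_proj U V (F t (X t))) {a..b}"
    "X a = U0 * S0 * V0\<^sup>T" "X b = Y" "S \<in> carrier_mat k k" "Y = U * S * V\<^sup>T"
    by (rule galerkin_step_lift[OF g I(2) U V UD S0 VD UU0 VV0 FX])
  show "\<exists>S. S \<in> carrier_mat k k \<and> Y = U * S * V\<^sup>T" using X(4,5) by blast
  have Xa: "X a = A a" using X(2) Y0 by simp
  have "frob_norm (galerkin_proj U V (F t (X t))) \<le> B" if t: "t \<in> {a..b}" for t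
    using frob_norm_galerkin_proj_le[OF U V FX[OF t]] FB[OF t] has_mat_derivativeD(1)[OF X(1) t]
    by (meson order_trans)
  from mat_drift_bound[OF X(1) this ab(2)] show "frob_norm (Y - A a) \<le> B * (b - a)"
    unfolding Xa X(3) .
  have PA: "galerkin_proj U V (A a) = A a"
    unfolding Y0 by (rule galerkin_proj_fixes[OF U V UU0 UD VV0 VD S0])
  have "frob_norm (A t - galerkin_proj U V (A t)) \<le> B * (b - a)" if t: "t \<in> {a..b}" for t
    using galerkin_proj_best_approx[OF U V AC[OF t] AC[OF ab(1)] PA]
      mat_drift_bound[OF A FB[OF _ AC] t] by linarith
  from galerkin_error[OF U V F \<open>0 \<le> L\<close> I A X(1) Xa PA this] defect
  show "frob_norm (Y - A b) \<le> L * (1 + exp (2 * L * (b - a))) * B * (b - a)\<^sup>2 + \<delta>"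
    unfolding X(3) by (simp add: power2_eq_square ac_simps)
qed

text \<open>The defect as a function of time inherits the zero at \<open>c - d\<close> and the third derivative bound
  from \<open>A\<close>, because \<open>I - P\<close> is a contraction that does not depend on time.\<close>

lemma projected_solution_interpolation:
  assumes U: "orthonormal_cols m k U" and V: "orthonormal_cols n l V" and "0 \<le> d"
    and A: "has_mat_derivative m n A A1 {c-d..c+d}" "has_mat_derivative m n A1 A2 {c-d..c+d}"
      "has_mat_derivative m n A2 A3 {c-d..c+d}"
    and bound: "\<And>t. t \<in> {c-d..c+d} \<Longrightarrow> frob_norm (A3 t) \<le> D"
    and init: "galerkin_proj U V (A (c - d)) = A (c - d)"
  defines "R \<equiv> \<lambda>Z. frob_norm (Z - galerkin_proj U V Z)"
  shows "R (A (c + d)) \<le> 2 * d * R (A1 c) + 2 * D * d^3"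
    and "t \<in> {c-d..c+d} \<Longrightarrow> R (A t) \<le> 2 * R (A c) + 2 * d * R (A1 c) + 2 * D * d^3"
proof -
  let ?R = "\<lambda>Z. Z - galerkin_proj U V Z"
  have d: "has_mat_derivative m n (\<lambda>t. ?R (X t)) (\<lambda>t. ?R (X' t)) {c-d..c+d}"
    if "has_mat_derivative m n X X' {c-d..c+d}" for X X'
    by (intro has_mat_derivative_minus has_mat_derivative_galerkin_proj[OF U V] that)
  have b: "frob_norm (?R (A3 t)) \<le> D" if "t \<in> {c-d..c+d}" for t
    using frob_norm_galerkin_defect_le[OF U V has_mat_derivativeD(2)[OF A(3) that]] bound[OF that] by linarith
  have "A (c - d) \<in> carrier_mat m n"
    by (rule has_mat_derivativeD(1)[OF A(1)]) (use \<open>0 \<le> d\<close> in simp)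
  hence z: "?R (A (c - d)) = 0\<^sub>m m n" unfolding init by (intro eq_matI) auto
  note M = mat_midpoint_interpolation[OF \<open>0 \<le> d\<close> d[OF A(1)] d[OF A(2)] d[OF A(3)] b z]
  show "R (A (c + d)) \<le> 2 * d * R (A1 c) + 2 * D * d^3" unfolding R_def by (rule M(1))
  show "R (A t) \<le> 2 * R (A c) + 2 * d * R (A1 c) + 2 * D * d^3" if "t \<in> {c-d..c+d}"
    unfolding R_def by (rule M(2)[OF _ that])
qed

text \<open>The number \<open>a\<close> bounds the defect of \<open>A\<close> at the midpoint and \<open>b\<close> the defect of its derivative there.
  The signs of the constants are by-products: each of them bounds a norm somewhere on the step.\<close>

lemma midpoint_local_error:
  assumes F: "lipschitz_bounded_field m n F T L B" and "0 \<le> L"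
    and I: "0 \<le> t0" "0 < h" "t0 + h \<le> T"
    and A: "has_mat_derivative m n A (\<lambda>t. F t (A t)) {0..T}"
    and D: "third_derivative_bound m n A {0..T} D"
    and \<rho>: "B * h < \<rho>"
    and N: "normal_component_bound m n r F T A \<rho> \<epsilon>r" "normal_component_bound m n rh F T A \<rho> \<epsilon>rh"
    and Y0: "A t0 \<in> rank_manifold m n r" and f: "low_rank_factors m n r (A t0) U0 S0 V0"
    and step: "midpoint_bug_step m n r rh F t0 h U0 S0 V0 Y1"
  defines "k \<equiv> h / 2"
  defines "a \<equiv> k * \<epsilon>r + 5 * L * B * k\<^sup>2"
  defines "b \<equiv> \<epsilon>rh + L * (L * (1 + exp (2 * L * k)) * B * k\<^sup>2 + a)"
  shows "frob_norm (Y1 - A (t0 + h)) \<le> 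
      h * (L * (1 + exp (2 * L * h)) * (2 * a + h * b + 2 * D * k^3)) + (h * b + 2 * D * k^3)"
    and "0 \<le> B" "0 \<le> D" "0 \<le> \<epsilon>r" "0 \<le> \<epsilon>rh"
proof -
  let ?c = "t0 + k"
  have k: "0 < k" "h = 2 * k" unfolding k_def using I by auto
  have cmd: "?c - k = t0" "?c + k = t0 + h" using k by auto
  have sub: "{t0..?c} \<subseteq> {0..T}" "{t0..t0 + h} \<subseteq> {0..T}" using I k by auto
  have t0: "t0 \<in> {0..T}" "t0 \<in> {t0..t0+h}" and c: "?c \<in> {0<..<T}" "?c \<in> {0..T}" "?c \<in> {t0..?c}" "?c \<in> {t0..t0+h}"
    using I k by auto
  have AC: "A t \<in> carrier_mat m n" and FA: "F t (A t) \<in> carrier_mat m n" "frob_norm (F t (A t)) \<le> B"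
    if "t \<in> {0..T}" for t
    using has_mat_derivativeD(1)[OF A that] lipschitz_bounded_fieldD(1,2)[OF F that] by auto
  show "0 \<le> B" using FA(2)[OF t0(1)] frob_norm_nonneg[of "F t0 (A t0)"] by linarith
  hence Bk: "B * k \<le> B * h" using k by (intro mult_left_mono) auto
  obtain A1 A2 A3 where A123: "has_mat_derivative m n A A1 {0..T}" "has_mat_derivative m n A1 A2 {0..T}"
    "has_mat_derivative m n A2 A3 {0..T}" and A3: "\<And>t. t \<in> {0..T} \<Longrightarrow> frob_norm (A3 t) \<le> D"
    using D unfolding third_derivative_bound_def by blast
  show "0 \<le> D" using A3[OF t0(1)] frob_norm_nonneg[of "A3 t0"] by linarith
  obtain Uh Vh Yh rb U V where half: "augmented_bug_step m n r rh F t0 (t0 + h / 2) U0 S0 V0 Uh Vh Yh"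
    and oU: "is_orth m rb (hcat m Uh (h \<cdot>\<^sub>m (F (t0 + h / 2) Yh * Vh))) U"
    and oV: "is_orth n rb (hcat n Vh (h \<cdot>\<^sub>m ((F (t0 + h / 2) Yh)\<^sup>T * Uh))) V"
    and full: "galerkin_step rb F t0 (t0 + h) U0 S0 V0 U V Y1"
    using step unfolding midpoint_bug_step_def by blast
  note half = half[folded k_def] and oU = oU[folded k_def] and oV = oV[folded k_def]
  have Ah: "has_mat_derivative m n A (\<lambda>t. F t (A t)) {t0..?c}"
    and Af: "has_mat_derivative m n A (\<lambda>t. F t (A t)) {t0..t0 + h}"
    using has_mat_derivative_subset[OF A] sub by auto
  have drift: "frob_norm (A t - A t0) \<le> B * k" if "t \<in> {t0..?c}" for t
    using mat_drift_bound[OF Ah FA(2) that] sub by auto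
  have normal: "frob_norm (normal_proj U0 V0 (F t (A t0))) \<le> \<epsilon>r" if t: "t \<in> {t0..?c}" for t
  proof -
    have "frob_norm (A t0 - A t) < \<rho>"
      using drift[OF t] Bk \<rho> frob_norm_minus_commute[OF AC[OF t0(1)] AC] t sub by force
    thus ?thesis using N(1) Y0 f t sub unfolding normal_component_bound_def by blast
  qed
  show "0 \<le> \<epsilon>r" using normal[OF c(3)] frob_norm_nonneg order_trans by blast
  have normal_all: "\<forall>t\<in>{t0..?c}. frob_norm (normal_proj U0 V0 (F t (A t0))) \<le> \<epsilon>r"
    using normal by blast
  have ck: "?c - t0 = k" by simp
  have cI: "t0 \<le> ?c" "?c \<le> T" using c k by auto
  note H = half_step_accuracy[OF F \<open>0 \<le> L\<close> I(1) cI Ah f normal_all half, unfolded ck, folded a_def]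
  note Uh = H(1) and Vh = H(2)
  obtain S where S: "S \<in> carrier_mat rh rh" "Yh = Uh * S * Vh\<^sup>T" using H(5) by blast
  note UhC = orthonormal_colsD(1)[OF Uh] and VhC = orthonormal_colsD(1)[OF Vh]
  have YhC: "Yh \<in> carrier_mat m n" using S UhC VhC by auto
  let ?F = "F ?c Yh"
  note FC = lipschitz_bounded_fieldD(1)[OF F c(2) YhC]
  \<comment> \<open>Both matrices are within \<open>B h / 2\<close> of the initial value, so the radius \<open>B h\<close> suffices.\<close>
  have "frob_norm (Yh - A ?c) < \<rho>"
    using frob_norm_triangle[OF YhC AC[OF t0(1)] AC[OF c(2)]] H(6) drift[OF c(3)] \<rho> k
      frob_norm_minus_commute[OF AC[OF t0(1)] AC[OF c(2)]] by (simp add: algebra_simps)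
  hence normal_mid: "frob_norm (normal_proj Uh Vh ?F) \<le> \<epsilon>rh"
    using normal_component_bound_factored[OF N(2) c(2) AC[OF c(2)] F \<open>0 \<le> L\<close> Uh Vh S(1)] S(2) by simp
  show "0 \<le> \<epsilon>rh" using normal_mid frob_norm_nonneg order_trans by blast

  have FV: "?F * Vh \<in> carrier_mat m rh" and FU: "?F\<^sup>T * Uh \<in> carrier_mat n rh" using FC UhC VhC by auto
  have U: "orthonormal_cols m rb U" and V: "orthonormal_cols n rb V"
    using oU oV unfolding is_orth_def by auto
  have UUh: "(U * U\<^sup>T) * Uh = Uh" and VVh: "(V * V\<^sup>T) * Vh = Vh"
    using is_orth_hcat_fixes(1)[OF oU UhC smult_carrier_mat[OF FV]]
      is_orth_hcat_fixes(1)[OF oV VhC smult_carrier_mat[OF FU]] .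
  have "(U * U\<^sup>T) * (h \<cdot>\<^sub>m (?F * Vh)) = h \<cdot>\<^sub>m (?F * Vh)" "(V * V\<^sup>T) * (h \<cdot>\<^sub>m (?F\<^sup>T * Uh)) = h \<cdot>\<^sub>m (?F\<^sup>T * Uh)"
    using is_orth_hcat_fixes(2)[OF oU UhC smult_carrier_mat[OF FV]]
      is_orth_hcat_fixes(2)[OF oV VhC smult_carrier_mat[OF FU]] .
  hence UF: "(U * U\<^sup>T) * (?F * Vh) = ?F * Vh" and VF: "(V * V\<^sup>T) * (?F\<^sup>T * Uh) = ?F\<^sup>T * Uh"
    using mult_smult_fixes_cancel[OF orthonormal_colsD(3)[OF U] FV, of h]
      mult_smult_fixes_cancel[OF orthonormal_colsD(3)[OF V] FU, of h] \<open>0 < h\<close> by simp_all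

  let ?P = "galerkin_proj U V"
  let ?R = "\<lambda>Z. frob_norm (Z - ?P Z)"
  \<comment> \<open>The bases of the second step contain those of the first, so the defect at the midpoint has not
  increased.\<close>
  have Rc: "?R (A ?c) \<le> a"
  proof -
    have "?P (galerkin_proj Uh Vh (A ?c)) = galerkin_proj Uh Vh (A ?c)"
      unfolding galerkin_proj_factored[OF Uh Vh AC[OF c(2)]]
      by (rule galerkin_proj_fixes[OF U V UUh UhC VVh VhC]) (use UhC VhC AC[OF c(2)] in auto)
    from galerkin_proj_best_approx[OF U V AC[OF c(2)] galerkin_proj_carrier[OF Uh Vh] this] H(7)
    show ?thesis by linarith
  qed
  \<comment> \<open>The midpoint is interior, so the derivative there is unique.\<close>
  have A1c: "A1 ?c = F ?c (A ?c)"
  proof (rule eq_matI)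
    have at: "at ?c within {0..T} = at ?c" using c(1) by (simp add: at_within_Icc_at)
    fix i j assume "i < dim_row (F ?c (A ?c))" "j < dim_col (F ?c (A ?c))"
    hence "i < m" "j < n" using FA(1)[OF c(2)] by auto
    thus "A1 ?c $$ (i, j) = F ?c (A ?c) $$ (i, j)"
      using has_mat_derivativeD(3)[OF A123(1) c(2)] has_mat_derivativeD(3)[OF A c(2)] DERIV_unique
      unfolding at by blast
  qed (use has_mat_derivativeD(2)[OF A123(1) c(2)] FA(1)[OF c(2)] in auto)
  have R1c: "?R (A1 ?c) \<le> b"
  proof -
    note T = augmented_basis_captures_tangent[OF Uh Vh FC U UUh UF V VVh VF]
    have "?R (A1 ?c) \<le> frob_norm (F ?c (A ?c) - tangent_proj Uh Vh ?F)"
      unfolding A1c by (rule galerkin_proj_best_approx[OF U V FA(1)[OF c(2)] T])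
    also have "\<dots> \<le> frob_norm (F ?c (A ?c) - ?F) + frob_norm (?F - tangent_proj Uh Vh ?F)"
      by (rule frob_norm_triangle[OF FA(1)[OF c(2)] FC T(1)])
    also have "\<dots> \<le> L * frob_norm (A ?c - Yh) + \<epsilon>rh"
      using lipschitz_bounded_fieldD(3)[OF F c(2) AC[OF c(2)] YhC] normal_mid
      unfolding normal_proj_def by linarith
    also have "L * frob_norm (A ?c - Yh) \<le> L * (L * (1 + exp (2 * L * k)) * B * k\<^sup>2 + a)"
      using H(8) frob_norm_minus_commute[OF AC[OF c(2)] YhC] \<open>0 \<le> L\<close> by (intro mult_left_mono) auto
    finally show ?thesis unfolding b_def by linarith
  qed

  have U0: "U0 \<in> carrier_mat m r" and V0: "V0 \<in> carrier_mat n r" and S0: "S0 \<in> carrier_mat r r"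
    and A0: "A t0 = U0 * S0 * V0\<^sup>T"
    using f unfolding low_rank_factors_def orthonormal_cols_def by auto
  have UU0: "(U * U\<^sup>T) * U0 = U0" and VV0: "(V * V\<^sup>T) * V0 = V0"
    using nested_bases_fix[OF U UhC U0 UUh H(3)] nested_bases_fix[OF V VhC V0 VVh H(4)] .
  have PA: "?P (A t0) = A t0"
    unfolding A0 by (rule galerkin_proj_fixes[OF U V UU0 U0 VV0 V0 S0])
  have der: "has_mat_derivative m n A A1 {?c-k..?c+k}" "has_mat_derivative m n A1 A2 {?c-k..?c+k}"
      "has_mat_derivative m n A2 A3 {?c-k..?c+k}"
    using A123 has_mat_derivative_subset sub(2) unfolding cmd by blast+
  have A3': "frob_norm (A3 t) \<le> D" if "t \<in> {?c-k..?c+k}" for t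
    using A3 that sub(2) unfolding cmd by blast
  have init: "?P (A (?c - k)) = A (?c - k)" unfolding cmd by (rule PA)
  have hR: "2 * k * ?R (A1 ?c) \<le> h * b"
    using R1c k by (simp add: mult_left_mono)
  note M = projected_solution_interpolation[OF U V less_imp_le[OF k(1)] der A3' init]
  have end_defect: "?R (A (t0 + h)) \<le> h * b + 2 * D * k^3"
    using M(1) hR unfolding cmd by linarith
  have defect: "?R (A t) \<le> 2 * a + h * b + 2 * D * k^3" if "t \<in> {t0..t0 + h}" for t
    using M(2)[of t] that hR Rc unfolding cmd by linarith
  obtain X S' where X: "has_mat_derivative m n X (\<lambda>t. ?P (F t (X t))) {t0..t0 + h}"
    "X t0 = U0 * S0 * V0\<^sup>T" "X (t0 + h) = Y1" "S' \<in> carrier_mat rb rb" "Y1 = U * S' * V\<^sup>T"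
  proof (rule galerkin_step_lift[OF full _ U V U0 S0 V0 UU0 VV0])
    show "F t Z \<in> carrier_mat m n" if "t \<in> {t0..t0 + h}" "Z \<in> carrier_mat m n" for t Z
      using lipschitz_bounded_fieldD(1)[OF F _ that(2)] that(1) sub(2) by blast
  qed (use I in auto)
  have "X t0 = A t0" using X(2) A0 by simp
  from galerkin_error[OF U V F \<open>0 \<le> L\<close> I(1) _ I(3) Af X(1) this PA defect] end_defect \<open>0 < h\<close>
  show "frob_norm (Y1 - A (t0 + h)) \<le> 
      h * (L * (1 + exp (2 * L * h)) * (2 * a + h * b + 2 * D * k^3)) + (h * b + 2 * D * k^3)"
    unfolding X(3) by (simp add: add.commute)
qed

text \<open>Each of \<open>a\<close>, \<open>b\<close> and \<open>D k\<^sup>2\<close> is at most a constant times \<open>w\<close>.  Of the factors \<open>h\<close>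
  the outermost is kept, and any further one is estimated by \<open>hmax\<close>.\<close>

lemma local_error_constant:
  fixes L B D hmax h p q :: real
  assumes nonneg: "0 \<le> L" "0 \<le> B" "0 \<le> D" "0 \<le> p" "0 \<le> q" and h: "0 < h" "h \<le> hmax"
  defines "M \<equiv> L * (1 + exp (2 * L * hmax))"
  defines "\<gamma> \<equiv> 1 + L * (1 + M * B + 5 * L * B)"
  defines "k \<equiv> h / 2"
  defines "a \<equiv> k * p + 5 * L * B * k\<^sup>2"
  defines "b \<equiv> q + L * (L * (1 + exp (2 * L * k)) * B * k\<^sup>2 + a)"
  defines "w \<equiv> h^2 + h * p + q"
  shows "h * (L * (1 + exp (2 * L * h)) * (2 * a + h * b + 2 * D * k^3)) + (h * b + 2 * D * k^3)
    \<le> (M * (2 * (1 + 5 * L * B) + hmax * (\<gamma> + D)) + \<gamma> + D) * h * w"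
proof -
  have k: "0 < k" "k \<le> h" "k \<le> hmax" unfolding k_def using h by auto
  have M: "L * (1 + exp (2 * L * s)) \<le> M" if "s \<le> hmax" for s
    unfolding M_def using nonneg that by (intro mult_left_mono add_left_mono) (auto intro: mult_left_mono)
  have "0 \<le> M" unfolding M_def using nonneg by (simp add: add_nonneg_nonneg)
  have w: "0 \<le> w" "h\<^sup>2 \<le> w" "h * p \<le> w" "q \<le> w" unfolding w_def using nonneg h by auto
  have k2: "k\<^sup>2 \<le> w" using power_mono[OF k(2) less_imp_le[OF k(1)], of 2] w(2) by linarith
  have kp: "k * p \<le> w" using mult_right_mono[OF k(2) nonneg(4)] w(3) by simp
  have k3: "2 * D * k^3 \<le> h * (D * w)"
  proof -
    have "2 * k^3 = h * k\<^sup>2" unfolding k_def by (simp add: power3_eq_cube power2_eq_square)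
    hence "2 * D * k^3 = h * (D * k\<^sup>2)" by (simp add: ac_simps)
    also have "\<dots> \<le> h * (D * w)" using k2 nonneg h by (intro mult_left_mono) auto
    finally show ?thesis .
  qed
  have a: "a \<le> (1 + 5 * L * B) * w"
    unfolding a_def using kp mult_left_mono[OF k2, of "5 * L * B"] nonneg by (simp add: algebra_simps)
  have "L * (1 + exp (2 * L * k)) * B * k\<^sup>2 \<le> M * B * w"
    using M[OF k(3)] k2 nonneg \<open>0 \<le> M\<close> w(1) by (intro mult_mono) auto
  hence "L * (L * (1 + exp (2 * L * k)) * B * k\<^sup>2 + a) \<le> L * (M * B * w + (1 + 5 * L * B) * w)"
    using a nonneg by (intro mult_left_mono add_mono) auto
  hence b: "b \<le> \<gamma> * w" unfolding b_def \<gamma>_def using w(4) by (simp add: algebra_simps)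
  have tail: "h * b + 2 * D * k^3 \<le> h * ((\<gamma> + D) * w)"
  proof -
    have "h * b \<le> h * (\<gamma> * w)" using b h(1) by (intro mult_left_mono) auto
    moreover have "h * ((\<gamma> + D) * w) = h * (\<gamma> * w) + h * (D * w)" by (simp add: algebra_simps)
    ultimately show ?thesis using k3 by linarith
  qed
  have "0 \<le> \<gamma> + D" unfolding \<gamma>_def using nonneg \<open>0 \<le> M\<close> by simp
  hence "h * ((\<gamma> + D) * w) \<le> hmax * ((\<gamma> + D) * w)"
    using h(2) w(1) by (intro mult_right_mono) auto
  hence "2 * a + h * b + 2 * D * k^3 \<le> (2 * (1 + 5 * L * B) + hmax * (\<gamma> + D)) * w" (is "?x \<le> ?y")
    using a tail by (simp add: algebra_simps)
  moreover have "0 \<le> ?y"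
  proof -
    have "0 \<le> hmax * (\<gamma> + D)" using h \<open>0 \<le> \<gamma> + D\<close> by (intro mult_nonneg_nonneg) auto
    thus ?thesis using nonneg w(1) by (intro mult_nonneg_nonneg[OF add_nonneg_nonneg]) auto
  qed
  ultimately have "L * (1 + exp (2 * L * h)) * ?x \<le> M * ?y"
    using M[OF h(2)] nonneg \<open>0 \<le> M\<close>
    by (meson exp_ge_zero add_nonneg_nonneg mult_left_mono mult_nonneg_nonneg mult_right_mono order_trans zero_le_one)
  hence "h * (L * (1 + exp (2 * L * h)) * ?x) \<le> h * (M * ?y)"
    using h by (intro mult_left_mono) auto
  with tail show ?thesis by (simp add: algebra_simps)
qed

theorem theorem1:
  fixes L B D hmax :: real
  shows "\<exists>C::real. \<forall>(m::nat) (n::nat) (r::nat) (rh::nat)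
      (F :: real \<Rightarrow> real mat \<Rightarrow> real mat) (A :: real \<Rightarrow> real mat) (T::real) (t0::real) (h::real)
      (\<rho>::real) (\<epsilon>r::real) (\<epsilon>rh::real) (Y0 :: real mat) (U0 :: real mat) (S0 :: real mat)
      (V0 :: real mat) (Y1 :: real mat).
    0 \<le> t0 \<and> 0 < h \<and> t0 + h \<le> T \<and> h \<le> hmax \<and>
    has_mat_derivative m n A (\<lambda>t. F t (A t)) {0..T} \<and>
    third_derivative_bound m n A {0..T} D \<and>
    lipschitz_bounded_field m n F T L B \<and>
    B * h < \<rho> \<and>
    normal_component_bound m n r F T A \<rho> \<epsilon>r \<and>
    normal_component_bound m n rh F T A \<rho> \<epsilon>rh \<and>
    A t0 = Y0 \<and> Y0 \<in> rank_manifold m n r \<and> low_rank_factors m n r Y0 U0 S0 V0 \<and>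
    midpoint_bug_step m n r rh F t0 h U0 S0 V0 Y1
    \<longrightarrow> frob_norm (Y1 - A (t0 + h)) \<le> C * h * (h^2 + h * \<epsilon>r + \<epsilon>rh)"
proof -
  \<comment> \<open>A negative \<open>L\<close> cannot be excluded: it is a Lipschitz constant when \<open>m n = 0\<close>.\<close>
  define L' where "L' = max L 0"
  define M where "M = L' * (1 + exp (2 * L' * hmax))"
  define \<gamma> where "\<gamma> = 1 + L' * (1 + M * B + 5 * L' * B)"
  show ?thesis
  proof (intro exI[of _ "M * (2 * (1 + 5 * L' * B) + hmax * (\<gamma> + D)) + \<gamma> + D"] allI impI, elim conjE)
    fix m n r rh :: nat and F :: "real \<Rightarrow> real mat \<Rightarrow> real mat" and A :: "real \<Rightarrow> real mat"
      and T t0 h \<rho> \<epsilon>r \<epsilon>rh :: real and Y0 U0 S0 V0 Y1 :: "real mat"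
    assume t0: "0 \<le> t0" and h: "0 < h" and T: "t0 + h \<le> T" and hmax: "h \<le> hmax"
      and A: "has_mat_derivative m n A (\<lambda>t. F t (A t)) {0..T}"
      and D: "third_derivative_bound m n A {0..T} D"
      and F: "lipschitz_bounded_field m n F T L B"
      and \<rho>: "B * h < \<rho>"
      and N: "normal_component_bound m n r F T A \<rho> \<epsilon>r" "normal_component_bound m n rh F T A \<rho> \<epsilon>rh"
      and Y0: "A t0 = Y0" "Y0 \<in> rank_manifold m n r" "low_rank_factors m n r Y0 U0 S0 V0"
      and step: "midpoint_bug_step m n r rh F t0 h U0 S0 V0 Y1"
    have L': "0 \<le> L'" "L \<le> L'" unfolding L'_def by auto
    note E = midpoint_local_error[OF lipschitz_bounded_field_mono[OF F L'(2)] L'(1) t0 h T A D \<rho> N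
      Y0(2,3)[folded Y0(1)] step]
    show "frob_norm (Y1 - A (t0 + h)) \<le>
        (M * (2 * (1 + 5 * L' * B) + hmax * (\<gamma> + D)) + \<gamma> + D) * h * (h^2 + h * \<epsilon>r + \<epsilon>rh)"
      using E(1) local_error_constant[OF L'(1) E(2-5) h hmax, folded M_def, folded \<gamma>_def]
      by (rule order_trans)
  qed
qed

end
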